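(* Let $K_1,K_2:[0,1]\times[0,1]\to\mathbb{R}$ satisfy condition (H1') (see context), with associated $G_i,\rho_i,M_i,\beta_i$, $i=1,2$. Let $L$ be a Lévy sheet with exponent $\Psi(\xi)=a(\xi)+ib(\xi)$, and let $\theta\in(0,2\pi)$ be such that $a(\theta)a(2\theta)\cdots a(m\theta)\ne0$, where $m$ is the even number appearing in the conclusion below. Let $K=\frac1{\sqrt2}\frac{a(\theta)^2+b(\theta)^2}{a(\theta)}$ and consider the kernels $$\theta_n^1(x,y)=nK\sqrt{xy}\cos(\theta L(\sqrt n\,x,\sqrt n\,y)),\qquad \theta_n^2(x,y)=nK\sqrt{xy}\sin(\theta L(\sqrt n\,x,\sqrt n\,y)),\qquad n\in\mathbb{N}.$$ Let $\theta_n$ be either $\theta_n^1$ (for all $n$) or $\theta_n^2$ (for all $n$), and for $0\le s\le s'\le1$, $0\le t\le t'\le1$ let $Y_n$ (which depends on $s,t,s',t',K_1,K_2$) be the process $$Y_n(s_0,t_0)=\int_{[0,s_0]\times[0,t_0]}(K_1(s',x)-K_1(s,x))(K_2(t',y)-K_2(t,y))\,\theta_n(x,y)\,dx\,dy .$$ Then, for any $0<s_0<s_0'<2s_0$ and $0<t_0<t_0'<2t_0$ (points of $[0,1]$), there exists an even number $m>\frac{4}{\min\{\rho_1,\rho_2\}}$ such that $$E\left[\left(\Delta_{s_0,t_0}Y_n(s_0',t_0')\right)^m\right]\le C_{m,M}\,(G_1(s')-G_1(s))^{\frac{m\rho_1}4}(G_2(t')-G_2(t))^{\frac{m\rho_2}4}\left[(s_0'-s_0)(t_0'-t_0)\right]^{m\gamma},$$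 where $\gamma$ is a parameter belonging to the interval $(0,1)$ that only depends on $\beta_1$ and $\beta_2$, and the constant $C_{m,M}$ only depends on $m$, $M_1$ and $M_2$.
   Context: For a function $X$ of two variables and $s\le s'$, $t\le t'$, $\Delta_{s,t}X(s',t')=X(s',t')-X(s',t)-X(s,t')+X(s,t)$. **(H1')** For $i=1,2$: (i) $K_i$ is measurable and $K_i(0,r)=0$ for almost every $r\in[0,1]$; (ii') there exist an increasing continuous function $G_i:[0,1]\to\mathbb{R}$ and $0<\rho_i\le1$ such that for all $0\le s<s'\le1$, $\int_0^1(K_i(s',r)-K_i(s,r))^2dr\le (G_i(s')-G_i(s))^{\rho_i}$; (iii) there exist constants $M_i>0$, $\beta_i>0$ such that for all $0\le s<s'\le1$ and $0\le s_0<s_0'\le1$, $\int_{s_0}^{s_0'}(K_i(s',r)-K_i(s,r))^2dr\le M_i(s_0'-s_0)^{\beta_i}$. **Lévy sheet.** A Lévy sheet with exponent $\Psi$ is a real-valued random field $L=\{L(s,t);s,t\ge0\}$, continuous in probability, such that increments over disjoint rectangles of $\mathbb{R}_+^2$ are independent and, for every rectangle $Q\subset\mathbb{R}_+^2$ with increment $\Delta_QL$, $E[e^{i\xi\Delta_QL}]=e^{-\lambda(Q)\Psi(\xi)}$ for $\xi\in\mathbb{R}$, where $\lambda$ is Lebesgue measure; $L$ is taken to vanish on the axes, so that $L(s,t)=\Delta_{0,0}L(s,t)$. By the Lévy–Khintchine formula, $\Psi=a+ib$ with $a(\xi)=\frac12\sigma^2\xi^2+\int_{\mathbb{R}}[1-\cos(\xi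 x)]\eta(dx)\ge 0$ and $b(\xi)=a_0\xi+\int_{\mathbb{R}}\left[\frac{x\xi}{1+|x|^2}-\sin(\xi x)\right]\eta(dx)$, where $a_0\in\mathbb{R}$, $\sigma\ge0$ and $\eta$ is a Borel measure on $\mathbb{R}\setminus\{0\}$ with $\int\frac{|x|^2}{1+|x|^2}\eta(dx)<\infty$.
   Formalization: The constant C_{m,M} may also depend on the exponent Ψ=a+ib and on θ (independence of these fails, since K is unbounded as a(θ) tends to 0), and L is assumed jointly measurable so that Y_n and its moments are defined. *)

theory Defs
  imports "HOL-Probability.Probability"
begin

definition rect_incr :: "(real \<Rightarrow> real \<Rightarrow> real) \<Rightarrow> real \<Rightarrow> real \<Rightarrow> real \<Rightarrow> real \<Rightarrow> real" where
  "rect_incr X s t s' t' = X s' t' - X s' t - X s t' + X s t"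

text \<open>Condition (H1') for one kernel on the unit square; values outside the square are irrelevant.
  The integrals are nonnegative (extended) integrals, so both bounds entail square integrability;
  with the Bochner integral they would hold trivially for non-integrable functions.\<close>

definition kernel_cond ::
  "(real \<Rightarrow> real \<Rightarrow> real) \<Rightarrow> (real \<Rightarrow> real) \<Rightarrow> real \<Rightarrow> real \<Rightarrow> real \<Rightarrow> bool" where
  "kernel_cond K G \<rho> M \<beta> \<longleftrightarrow>
     (\<lambda>(s, r). K s r) \<in> borel_measurable (restrict_space borel ({0..1} \<times> {0..1})) \<and>
     (AE r in lborel. r \<in> {0..1} \<longrightarrow> K 0 r = 0) \<and>
     mono_on {0..1} G \<and> continuous_on {0..1} G \<and> 0 < \<rho> \<and> \<rho> \<le> 1 \<and>
     (\<forall>s s'. 0 \<le> s \<and> s < s' \<and> s' \<le> 1 \<longrightarrow>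
        (\<integral>\<^sup>+ r\<in>{0..1}. ennreal ((K s' r - K s r)\<^sup>2) \<partial>lborel) \<le> ennreal ((G s' - G s) powr \<rho>)) \<and>
     0 < M \<and> 0 < \<beta> \<and>
     (\<forall>s s' s0 s0'. 0 \<le> s \<and> s < s' \<and> s' \<le> 1 \<and> 0 \<le> s0 \<and> s0 < s0' \<and> s0' \<le> 1 \<longrightarrow>
        (\<integral>\<^sup>+ r\<in>{s0..s0'}. ennreal ((K s' r - K s r)\<^sup>2) \<partial>lborel) \<le> ennreal (M * (s0' - s0) powr \<beta>))"

text \<open>A rectangle of the quadrant is encoded by its corners \<open>((s, t), (s', t'))\<close>; it is the
  half-open set \<open>(s, s'] \<times> (t, t']\<close>, so adjacent rectangles count as disjoint.\<close>

type_synonym rect = "(real \<times> real) \<times> (real \<times> real)"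

definition is_rect :: "rect \<Rightarrow> bool" where
  "is_rect = (\<lambda>((s, t), (s', t')). 0 \<le> s \<and> s < s' \<and> 0 \<le> t \<and> t < t')"

definition rect_set :: "rect \<Rightarrow> (real \<times> real) set" where
  "rect_set = (\<lambda>((s, t), (s', t')). {s<..s'} \<times> {t<..t'})"

definition sheet_incr :: "(real \<Rightarrow> real \<Rightarrow> 'a \<Rightarrow> real) \<Rightarrow> rect \<Rightarrow> 'a \<Rightarrow> real" where
  "sheet_incr L = (\<lambda>((s, t), (s', t')) \<omega>. rect_incr (\<lambda>x y. L x y \<omega>) s t s' t')"

text \<open>The exponent is determined by the sheet. Its Levy-Khintchine representation is a consequence
  of this definition, not a part of it.\<close>

definition levy_sheet ::
  "'a measure \<Rightarrow> (real \<Rightarrow> real \<Rightarrow> 'a \<Rightarrow> real) \<Rightarrow> (real \<Rightarrow> complex) \<Rightarrow> bool" where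
  "levy_sheet M L \<Psi> \<longleftrightarrow>
     prob_space M \<and>
     (\<forall>s\<ge>0. \<forall>t\<ge>0. L s t \<in> borel_measurable M) \<and>
     (\<forall>u\<ge>0. (AE \<omega> in M. L u 0 \<omega> = 0) \<and> (AE \<omega> in M. L 0 u \<omega> = 0)) \<and>
     (\<forall>s\<ge>0. \<forall>t\<ge>0. \<forall>\<epsilon>>0.
        ((\<lambda>(s', t'). measure M {\<omega> \<in> space M. \<epsilon> < \<bar>L s' t' \<omega> - L s t \<omega>\<bar>}) \<longlongrightarrow> 0)
          (at (s, t) within {0..} \<times> {0..})) \<and>
     (\<forall>R. finite R \<and> (\<forall>Q\<in>R. is_rect Q) \<and> disjoint_family_on rect_set R \<longrightarrow>
        prob_space.indep_vars M (\<lambda>_. borel) (sheet_incr L) R) \<and>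
     (\<forall>Q \<xi>. is_rect Q \<longrightarrow>
        char (distr M borel (sheet_incr L Q)) \<xi>
          = exp (- complex_of_real (measure lborel (rect_set Q)) * \<Psi> \<xi>))"

text \<open>Joint measurability in \<open>(x, y, \<omega>)\<close>: continuity in probability alone gives it only for a
  suitable version of the sheet, and without it the pathwise integrals below need not make sense.\<close>

definition measurable_field :: "'a measure \<Rightarrow> (real \<Rightarrow> real \<Rightarrow> 'a \<Rightarrow> real) \<Rightarrow> bool" where
  "measurable_field M L \<longleftrightarrow>
     (\<lambda>((x, y), \<omega>). L x y \<omega>)
       \<in> borel_measurable (restrict_space borel ({0..} \<times> {0..}) \<Otimes>\<^sub>M M)"

definition norm_const :: "(real \<Rightarrow> real) \<Rightarrow> (real \<Rightarrow> real) \<Rightarrow> real \<Rightarrow> real" where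
  "norm_const a b \<theta> = 1 / sqrt 2 * (((a \<theta>)\<^sup>2 + (b \<theta>)\<^sup>2) / a \<theta>)"

text \<open>The kernels \<open>\<theta>\<^sub>n\<^sup>1\<close> and \<open>\<theta>\<^sub>n\<^sup>2\<close> are the cases \<open>trig = cos\<close> and \<open>trig = sin\<close>; \<open>K\<close> is the
  normalising constant.\<close>

definition sheet_kernel ::
  "(real \<Rightarrow> real) \<Rightarrow> real \<Rightarrow> real \<Rightarrow> (real \<Rightarrow> real \<Rightarrow> 'a \<Rightarrow> real) \<Rightarrow>
   nat \<Rightarrow> real \<Rightarrow> real \<Rightarrow> 'a \<Rightarrow> real" where
  "sheet_kernel trig K \<theta> L n x y \<omega> =
     real n * K * sqrt (x * y) * trig (\<theta> * L (sqrt (real n) * x) (sqrt (real n) * y) \<omega>)"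

definition Y_process ::
  "(real \<Rightarrow> real \<Rightarrow> real) \<Rightarrow> (real \<Rightarrow> real \<Rightarrow> real) \<Rightarrow> real \<Rightarrow> real \<Rightarrow> real \<Rightarrow> real \<Rightarrow>
   (real \<Rightarrow> real \<Rightarrow> 'a \<Rightarrow> real) \<Rightarrow> 'a \<Rightarrow> real \<Rightarrow> real \<Rightarrow> real" where
  "Y_process K1 K2 s t s' t' Z \<omega> s0 t0 =
     (LINT p:{0..s0} \<times> {0..t0}|lborel.
        (K1 s' (fst p) - K1 s (fst p)) * (K2 t' (snd p) - K2 t (snd p)) * Z (fst p) (snd p) \<omega>)"

end

theory Submission
  imports Defs "HOL-Real_Asymp.Real_Asymp"
begin

text \<open>By Fubini the \<open>m\<close>-th moment is an integral over \<open>m\<close> points \<open>(x\<^sub>i, y\<^sub>i)\<close> of the rectangle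
  \<open>(s0, s0'] \<times> (t0, t0']\<close>; the integrand contains the expectation of the product of the
  \<open>trig (\<theta> L(\<surd>n x\<^sub>i, \<surd>n y\<^sub>i))\<close>, and the rest is deterministic. Writing \<open>cos\<close> and \<open>sin\<close> as exponentials
  reduces that expectation to \<open>E exp (i\<theta> \<Sum>\<^sub>i \<epsilon>\<^sub>i L(\<surd>n x\<^sub>i, \<surd>n y\<^sub>i))\<close> with signs \<open>\<epsilon>\<^sub>i\<close>.

  The grid through the points cuts the quadrant into cells on which the sheet has independent
  increments, so the modulus of this expectation is \<open>exp (- n \<integral> a(\<theta>\<phi>(u, v)) du dv)\<close>, where \<open>\<phi>(u, v)\<close> is
  the sum of the \<open>\<epsilon>\<^sub>i\<close> over the points with \<open>u \<le> x\<^sub>i\<close> and \<open>v \<le> y\<^sub>i\<close> (\<open>levy_sheet_grid_char\<close>). The values of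
  \<open>\<phi>\<close> are integers between \<open>-m\<close> and \<open>m\<close>. They are odd, hence not 0, wherever the number of these points
  is odd, and there \<open>a(\<theta>\<phi>) \<ge> \<alpha>\<close>, the smallest of \<open>a(\<theta>), \<dots>, a(m\<theta>)\<close>. In the strip \<open>v \<le> t0\<close> the number
  only depends on \<open>u\<close>: it is odd between the largest and the second largest of the \<open>x\<^sub>i\<close>, between the
  third and the fourth, and so on. The strip \<open>u \<le> s0\<close> behaves in the same way with respect to the \<open>y\<^sub>i\<close>,
  and since \<open>m\<close> is even the two regions are disjoint. Therefore the modulus is at most
  \<open>exp (- n \<alpha> t0 D(x)) exp (- n \<alpha> s0 D(y))\<close>, where \<open>D\<close> is the sum of these gaps
  (\<open>levy_sheet_joint_char_le\<close>).

  The variables \<open>x\<close> and \<open>y\<close> are now separated. Each exponential is at most a sum over all pairings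
  of products of \<open>exp (- \<kappa> \<bar>x\<^sub>p - x\<^sub>q\<bar>)\<close> (\<open>exp_odd_gap_le_pairing_weight\<close>), so the integral over the \<open>x\<^sub>i\<close>
  is at most \<open>m!\<close> times the power \<open>m / 2\<close> of a two-point integral. With \<open>f = K\<^sub>1(s', \<cdot>) - K\<^sub>1(s, \<cdot>)\<close>,
  \<open>g = K\<^sub>2(t', \<cdot>) - K\<^sub>2(t, \<cdot>)\<close> and \<open>\<kappa> = n \<alpha> t0\<close> the latter is of order \<open>s0 / (n t0) \<integral> f\<^sup>2\<close>, and for the \<open>y\<^sub>i\<close> it is of order
  \<open>t0 / (n s0) \<integral> g\<^sup>2\<close> (\<open>sheet_integral_moment_le\<close>). In the product \<open>s0\<close> and \<open>t0\<close> cancel and the factor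
  \<open>n ^ (- m)\<close> compensates the \<open>n ^ m\<close> of the kernels. Finally \<open>\<integral> f\<^sup>2\<close> over \<open>(s0, s0']\<close> is bounded by
  both (ii') and (iii), hence by the geometric mean of the two bounds, which is what produces the
  exponents \<open>m\<rho>\<^sub>1 / 4\<close> and \<open>m\<beta>\<^sub>1 / 4\<close>.\<close>

section \<open>Pairings of points\<close>

text \<open>The sum of \<open>\<Prod>\<^sub>j exp (- \<kappa> \<bar>x p\<^sub>j - x q\<^sub>j\<bar>)\<close> over all ways of listing the \<open>2k\<close> elements of \<open>I\<close>
  as ordered pairs \<open>(p\<^sub>1, q\<^sub>1), \<dots>, (p\<^sub>k, q\<^sub>k)\<close>. The bounds below hold for one pairing that depends on
  the order of the values \<open>x i\<close>; summing over all pairings removes that dependence and leaves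
  products of functions of two variables each.\<close>
primrec pairing_weight :: "real \<Rightarrow> nat \<Rightarrow> 'i set \<Rightarrow> ('i \<Rightarrow> real) \<Rightarrow> real" where
  "pairing_weight \<kappa> 0 I x = 1"
| "pairing_weight \<kappa> (Suc k) I x =
     (\<Sum>p\<in>I. \<Sum>q\<in>I - {p}. exp (- \<kappa> * \<bar>x p - x q\<bar>) * pairing_weight \<kappa> k (I - {p, q}) x)"

lemma pairing_weight_nonneg: "0 \<le> pairing_weight \<kappa> k I x"
  by (induction k arbitrary: I) (auto intro!: sum_nonneg)

lemma pairing_weight_cong:
  assumes "\<And>i. i \<in> I \<Longrightarrow> x i = y i"
  shows "pairing_weight \<kappa> k I x = pairing_weight \<kappa> k I y"
  using assms
proof (induction k arbitrary: I)
  case (Suc k)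
  have "pairing_weight \<kappa> k (I - {p, q}) x = pairing_weight \<kappa> k (I - {p, q}) y" for p q
    by (intro Suc.IH) (use Suc.prems in auto)
  then show ?case
    using Suc.prems by (auto intro!: sum.cong)
qed simp

lemma pairing_weight_measurable:
  assumes "J \<subseteq> I" "sets \<mu> = sets borel"
  shows "(\<lambda>x. pairing_weight \<kappa> k J x) \<in> borel_measurable (Pi\<^sub>M I (\<lambda>_. \<mu>))"
  using assms(1)
proof (induction k arbitrary: J)
  case 0
  then show ?case by simp
next
  case (Suc k)
  have coord: "(\<lambda>x. x i) \<in> borel_measurable (Pi\<^sub>M I (\<lambda>_. \<mu>))" if "i \<in> I" for i
    using measurable_component_singleton[OF that, of "\<lambda>_. \<mu>"] assms(2)
    by (simp cong: measurable_cong_sets)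
  have [measurable]: "pairing_weight \<kappa> k (J - {p, q}) \<in> borel_measurable (Pi\<^sub>M I (\<lambda>_. \<mu>))" for p q
    using Suc by blast
  show ?case
    unfolding pairing_weight.simps
  proof (intro borel_measurable_sum)
    fix p q assume "p \<in> J" "q \<in> J - {p}"
    then have [measurable]: "(\<lambda>x. x p) \<in> borel_measurable (Pi\<^sub>M I (\<lambda>_. \<mu>))"
       "(\<lambda>x. x q) \<in> borel_measurable (Pi\<^sub>M I (\<lambda>_. \<mu>))"
      using Suc.prems by (auto intro: coord)
    show "(\<lambda>x. exp (- \<kappa> * \<bar>x p - x q\<bar>) * pairing_weight \<kappa> k (J - {p, q}) x)
        \<in> borel_measurable (Pi\<^sub>M I (\<lambda>_. \<mu>))"
      by measurable
  qed
qed

text \<open>There are \<open>(2k)!\<close> ordered pairings, and by Fubini each of them contributes the \<open>k\<close>-th power of the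
  two-point integral.\<close>
lemma nn_integral_pairing_weight_le:
  fixes \<mu> :: "real measure" and I :: "'i set"
  assumes "sigma_finite_measure \<mu>" and sets: "sets \<mu> = sets borel"
    and "finite I" "card I = 2 * k"
  shows "(\<integral>\<^sup>+x. ennreal (pairing_weight \<kappa> k I x) \<partial>Pi\<^sub>M I (\<lambda>_. \<mu>))
    \<le> fact (2 * k) * (\<integral>\<^sup>+u. \<integral>\<^sup>+v. ennreal (exp (- \<kappa> * \<bar>u - v\<bar>)) \<partial>\<mu> \<partial>\<mu>) ^ k"
  (is "_ \<le> _ * ?H ^ k")
  using assms(3,4)
proof (induction k arbitrary: I)
  interpret sigma_finite_measure \<mu> by fact
  interpret product_sigma_finite "\<lambda>_::'i. \<mu>" by unfold_locales
  case 0
  then show ?case by (simp add: space_PiM)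
next
  interpret sigma_finite_measure \<mu> by fact
  interpret product_sigma_finite "\<lambda>_::'i. \<mu>" by unfold_locales
  case (Suc k)
  define P where "P J = Pi\<^sub>M J (\<lambda>_::'i. \<mu>)" for J
  have pair: "(\<integral>\<^sup>+x. ennreal (exp (- \<kappa> * \<bar>x p - x q\<bar>) * pairing_weight \<kappa> k (I - {p, q}) x) \<partial>P I)
      \<le> fact (2 * k) * ?H ^ Suc k" if pq: "p \<in> I" "q \<in> I - {p}" for p q
  proof -
    define J where "J = I - {p, q}"
    have I: "I = insert p (insert q J)" and pJ: "p \<notin> insert q J" and qJ: "q \<notin> J" "p \<noteq> q"
      and fin: "finite J" and card: "card J = 2 * k"
      using pq Suc.prems by (auto simp: J_def)
    note [measurable_cong] = sets
    have meas_exp: "(\<lambda>u. ennreal (exp (- \<kappa> * \<bar>u - v\<bar>))) \<in> borel_measurable \<mu>" for v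
      by measurable
    have coord: "(\<lambda>x. x i) \<in> borel_measurable (P K)" if "i \<in> K" for i K
      unfolding P_def using measurable_component_singleton[OF that, of "\<lambda>_. \<mu>"] sets
      by (simp cong: measurable_cong_sets)
    have w: "pairing_weight \<kappa> k J \<in> borel_measurable (P K)" if "J \<subseteq> K" for K
      unfolding P_def using that sets by (rule pairing_weight_measurable)
    have [measurable]: "pairing_weight \<kappa> k J \<in> borel_measurable (P J)"
      "pairing_weight \<kappa> k J \<in> borel_measurable (P (insert q J))"
      "pairing_weight \<kappa> k J \<in> borel_measurable (P I)"
      by (auto intro!: w simp: I)
    have [measurable]: "(\<lambda>x. x p) \<in> borel_measurable (P I)" "(\<lambda>x. x q) \<in> borel_measurable (P I)"
      "(\<lambda>x. x q) \<in> borel_measurable (P (insert q J))"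
      by (auto intro!: coord simp: I)
    have "(\<integral>\<^sup>+x. ennreal (exp (- \<kappa> * \<bar>x p - x q\<bar>) * pairing_weight \<kappa> k J x) \<partial>P I)
      = (\<integral>\<^sup>+x. \<integral>\<^sup>+u. ennreal (exp (- \<kappa> * \<bar>u - x q\<bar>) * pairing_weight \<kappa> k J (x(p := u))) \<partial>\<mu> \<partial>P (insert q J))"
      unfolding I P_def
      by (subst product_nn_integral_insert) (use fin pJ qJ in \<open>auto simp: P_def[symmetric] I[symmetric]\<close>)
    also have "\<dots> = (\<integral>\<^sup>+x. (\<integral>\<^sup>+u. ennreal (exp (- \<kappa> * \<bar>u - x q\<bar>)) \<partial>\<mu>) * pairing_weight \<kappa> k J x \<partial>P (insert q J))"
    proof (intro nn_integral_cong)
      fix x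
      have "pairing_weight \<kappa> k J (x(p := u)) = pairing_weight \<kappa> k J x" for u
        using pJ by (intro pairing_weight_cong) auto
      then show "(\<integral>\<^sup>+u. ennreal (exp (- \<kappa> * \<bar>u - x q\<bar>) * pairing_weight \<kappa> k J (x(p := u))) \<partial>\<mu>)
        = (\<integral>\<^sup>+u. ennreal (exp (- \<kappa> * \<bar>u - x q\<bar>)) \<partial>\<mu>) * pairing_weight \<kappa> k J x"
        using nn_integral_multc[OF meas_exp]
        by (simp add: ennreal_mult pairing_weight_nonneg)
    qed
    also have "\<dots> = (\<integral>\<^sup>+x. \<integral>\<^sup>+v. (\<integral>\<^sup>+u. ennreal (exp (- \<kappa> * \<bar>u - v\<bar>)) \<partial>\<mu>) * pairing_weight \<kappa> k J (x(q := v)) \<partial>\<mu> \<partial>P J)"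
      unfolding P_def
      by (subst product_nn_integral_insert) (use fin qJ in \<open>auto simp: P_def[symmetric]\<close>)
    also have "\<dots> = (\<integral>\<^sup>+x. ?H * pairing_weight \<kappa> k J x \<partial>P J)"
    proof (intro nn_integral_cong)
      fix x
      have "pairing_weight \<kappa> k J (x(q := v)) = pairing_weight \<kappa> k J x" for v
        using qJ by (intro pairing_weight_cong) auto
      then show "(\<integral>\<^sup>+v. (\<integral>\<^sup>+u. ennreal (exp (- \<kappa> * \<bar>u - v\<bar>)) \<partial>\<mu>) * pairing_weight \<kappa> k J (x(q := v)) \<partial>\<mu>)
        = ?H * pairing_weight \<kappa> k J x"
        by (simp add: nn_integral_multc abs_minus_commute)
    qed
    also have "\<dots> = ?H * (\<integral>\<^sup>+x. pairing_weight \<kappa> k J x \<partial>P J)"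
      by (simp add: nn_integral_cmult)
    also have "\<dots> \<le> ?H * (fact (2 * k) * ?H ^ k)"
      unfolding P_def by (intro mult_left_mono Suc.IH fin card) auto
    finally show ?thesis
      by (simp add: J_def ac_simps)
  qed
  have meas: "(\<lambda>x. ennreal (exp (- \<kappa> * \<bar>x p - x q\<bar>) * pairing_weight \<kappa> k (I - {p, q}) x))
      \<in> borel_measurable (P I)" if "p \<in> I" "q \<in> I" for p q
  proof -
    have [measurable]: "(\<lambda>x. x i) \<in> borel_measurable (P I)" if "i \<in> I" for i
      unfolding P_def using measurable_component_singleton[OF that, of "\<lambda>_. \<mu>"] sets
      by (simp cong: measurable_cong_sets)
    have [measurable]: "pairing_weight \<kappa> k (I - {p, q}) \<in> borel_measurable (P I)"
      unfolding P_def using sets by (intro pairing_weight_measurable) auto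
    show ?thesis using that by measurable
  qed
  have "(\<integral>\<^sup>+x. ennreal (pairing_weight \<kappa> (Suc k) I x) \<partial>P I)
    = (\<integral>\<^sup>+x. (\<Sum>p\<in>I. \<Sum>q\<in>I - {p}.
         ennreal (exp (- \<kappa> * \<bar>x p - x q\<bar>) * pairing_weight \<kappa> k (I - {p, q}) x)) \<partial>P I)"
    by (simp add: sum_ennreal sum_nonneg pairing_weight_nonneg)
  also have "\<dots> = (\<Sum>p\<in>I. \<Sum>q\<in>I - {p}.
      (\<integral>\<^sup>+x. ennreal (exp (- \<kappa> * \<bar>x p - x q\<bar>) * pairing_weight \<kappa> k (I - {p, q}) x) \<partial>P I))"
    by (subst nn_integral_sum, intro borel_measurable_sum meas, blast, blast)
      (intro sum.cong refl nn_integral_sum meas, blast+)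
  also have "\<dots> \<le> (\<Sum>p\<in>I. \<Sum>q\<in>I - {p}. fact (2 * k) * ?H ^ Suc k)"
    by (intro sum_mono pair) auto
  also have "\<dots> = of_nat (\<Sum>p\<in>I. card (I - {p})) * (fact (2 * k) * ?H ^ Suc k)"
    by (simp add: sum_distrib_right mult.assoc)
  also have "(\<Sum>p\<in>I. card (I - {p})) = (2 * Suc k) * Suc (2 * k)"
    using Suc.prems by simp
  also have "of_nat ((2 * Suc k) * Suc (2 * k)) * (fact (2 * k) * ?H ^ Suc k) = fact (2 * Suc k) * ?H ^ Suc k"
  proof -
    have "(2 * Suc k) * Suc (2 * k) * fact (2 * k) = (fact (2 * Suc k) :: nat)"
      by (simp add: algebra_simps)
    then have "of_nat ((2 * Suc k) * Suc (2 * k)) * fact (2 * k) = (fact (2 * Suc k) :: ennreal)"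
      by (metis of_nat_fact of_nat_mult)
    then show ?thesis by (simp only: mult.assoc[symmetric])
  qed
  finally show ?case unfolding P_def .
qed

text \<open>With grid points \<open>c\<close> and points \<open>c (k i)\<close>, this is the total length of the grid cells that lie
  below an odd number of points. If the number of points is even, it is the alternating sum
  \<open>(x\<^sub>1 - x\<^sub>2) + (x\<^sub>3 - x\<^sub>4) + \<dots>\<close> of the points in decreasing order.\<close>
definition odd_gap :: "(nat \<Rightarrow> real) \<Rightarrow> nat \<Rightarrow> 'i set \<Rightarrow> ('i \<Rightarrow> nat) \<Rightarrow> real" where
  "odd_gap c N I k = (\<Sum>j<N. (c (Suc j) - c j) * of_bool (odd (card {i \<in> I. j < k i})))"

text \<open>Take for \<open>p\<close> the largest point and for \<open>q\<close> the second largest. Between them a cell lies below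
  \<open>p\<close> only; below \<open>q\<close> both count, so that removing the pair does not change the parity.\<close>
lemma odd_gap_peel:
  assumes fin: "finite I" and card: "2 \<le> card I" and le: "\<And>i. i \<in> I \<Longrightarrow> k i \<le> N" and c: "mono c"
  obtains p q where "p \<in> I" "q \<in> I - {p}"
    "odd_gap c N I k = \<bar>c (k p) - c (k q)\<bar> + odd_gap c N (I - {p, q}) k"
proof -
  have "I \<noteq> {}" using card by auto
  have ex_max: "\<exists>p\<in>A. \<forall>i\<in>A. k i \<le> k p" if "A \<noteq> {}" "finite A" for A
    using that by (intro bexI[of _ "arg_min_on (\<lambda>i. - int (k i)) A"] ballI)
      (use arg_min_least[of A _ "\<lambda>i. - int (k i)"] arg_min_if_finite(1)[of A "\<lambda>i. - int (k i)"] in force)+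
  then obtain p where p: "p \<in> I" "\<And>i. i \<in> I \<Longrightarrow> k i \<le> k p"
    using \<open>I \<noteq> {}\<close> fin by metis
  have "I - {p} \<noteq> {}"
  proof
    assume "I - {p} = {}"
    then have "I = {p}" using p by auto
    then show False using card by simp
  qed
  with ex_max fin obtain q where q: "q \<in> I - {p}" "\<And>i. i \<in> I - {p} \<Longrightarrow> k i \<le> k q"
    by (metis finite_Diff)
  have qp: "k q \<le> k p" using p q by auto
  define J where "J = I - {p, q}"
  have I: "I = insert p (insert q J)" and J: "p \<notin> J" "q \<notin> J" "p \<noteq> q" "finite J"
    using p q fin by (auto simp: J_def)
  have parity: "of_bool (odd (card {i \<in> I. j < k i}))
      = (of_bool (j \<in> {k q..<k p}) + of_bool (odd (card {i \<in> J. j < k i})) :: real)" for j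
  proof (cases "j < k q")
    case True
    then have "{i \<in> I. j < k i} = insert p (insert q {i \<in> J. j < k i})"
      using qp I by auto
    then have "card {i \<in> I. j < k i} = Suc (Suc (card {i \<in> J. j < k i}))"
      using J by simp
    then show ?thesis using True by auto
  next
    case False
    then have none: "{i \<in> J. j < k i} = {}"
      using q(2) by (fastforce simp: J_def)
    have "i = p" if "i \<in> I" "j < k i" for i
      using that False q(2)[of i] by (cases "i = p") auto
    then have "{i \<in> I. j < k i} \<subseteq> {p}" by blast
    then have "{i \<in> I. j < k i} = (if j < k p then {p} else {})"
      using p(1) by auto
    then show ?thesis unfolding none using False by auto
  qed
  have "odd_gap c N I k = (\<Sum>j<N. (c (Suc j) - c j) * of_bool (j \<in> {k q..<k p})) + odd_gap c N J k"
    unfolding odd_gap_def parity by (simp add: ring_distribs sum.distrib)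
  also have "(\<Sum>j<N. (c (Suc j) - c j) * of_bool (j \<in> {k q..<k p})) = (\<Sum>j\<in>{k q..<k p}. c (Suc j) - c j)"
    using le[OF p(1)] by (intro sum.mono_neutral_cong_right) auto
  also have "\<dots> = \<bar>c (k p) - c (k q)\<bar>"
    using qp monoD[OF c qp] by (simp add: sum_Suc_diff')
  finally show ?thesis
    using that p q unfolding J_def by blast
qed

lemma exp_odd_gap_le_pairing_weight:
  assumes "finite I" "card I = 2 * n" "\<And>i. i \<in> I \<Longrightarrow> k i \<le> N" "mono c"
  shows "exp (- \<kappa> * odd_gap c N I k) \<le> pairing_weight \<kappa> n I (\<lambda>i. c (k i))"
  using assms(1-3)
proof (induction n arbitrary: I)
  case 0
  then show ?case by (simp add: odd_gap_def)
next
  case (Suc n)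
  obtain p q where pq: "p \<in> I" "q \<in> I - {p}"
    "odd_gap c N I k = \<bar>c (k p) - c (k q)\<bar> + odd_gap c N (I - {p, q}) k"
    using odd_gap_peel[where k = k, OF Suc.prems(1) _ Suc.prems(3) assms(4)] Suc.prems(2)
    by (metis (no_types, lifting) le_add1 mult_Suc_right)
  let ?t = "\<lambda>p q. exp (- \<kappa> * \<bar>c (k p) - c (k q)\<bar>) * pairing_weight \<kappa> n (I - {p, q}) (\<lambda>i. c (k i))"
  have "exp (- \<kappa> * odd_gap c N I k)
      = exp (- \<kappa> * \<bar>c (k p) - c (k q)\<bar>) * exp (- \<kappa> * odd_gap c N (I - {p, q}) k)"
    by (simp add: pq(3) ring_distribs exp_add[symmetric])
  also have "\<dots> \<le> ?t p q"
    using Suc.prems pq(1,2) by (intro mult_left_mono Suc.IH) auto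
  also have "\<dots> \<le> (\<Sum>q\<in>I - {p}. ?t p q)"
    using Suc.prems pq(2) by (intro member_le_sum) (auto simp: pairing_weight_nonneg)
  also have "\<dots> \<le> (\<Sum>p\<in>I. \<Sum>q\<in>I - {p}. ?t p q)"
    using Suc.prems pq(1) by (intro member_le_sum) (auto intro!: sum_nonneg simp: pairing_weight_nonneg)
  finally show ?case by simp
qed

section \<open>Characteristic functions of a Levy sheet at several points\<close>

text \<open>The grids are strictly increasing along all of \<open>nat\<close>, although only finitely many grid points
  matter: this avoids range conditions in every later comparison of grid points.\<close>
lemma ex_grid:
  assumes "finite A" "A \<subseteq> {0<..}"
  obtains c :: "nat \<Rightarrow> real" and N where "strict_mono c" "c 0 = 0" "A \<subseteq> c ` {..N}"
proof -
  have "\<exists>c N. strict_mono c \<and> c 0 = (0::real) \<and> insert 0 A = c ` {..N::nat}"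
    using assms
  proof (induction A rule: finite_linorder_max_induct)
    case empty
    have "strict_mono real \<and> real 0 = 0 \<and> insert 0 {} = real ` {..0}"
      by (auto simp: strict_mono_def)
    then show ?case by blast
  next
    case (insert b A)
    then obtain c N where c: "strict_mono c" "c 0 = (0::real)" "insert 0 A = c ` {..N::nat}"
      by auto
    have lt: "c j < b" if "j \<le> N" for j
      using c(3) that insert by (metis atMost_iff greaterThan_iff image_eqI insertE insert_subset)
    define c' where "c' j = (if j \<le> N then c j else b + real (j - Suc N))" for j
    have "strict_mono c'"
      unfolding strict_mono_Suc_iff
    proof
      fix j
      show "c' j < c' (Suc j)"
        using lt[of j] strict_monoD[OF c(1), of j "Suc j"] by (auto simp: c'_def Suc_diff_le)
    qed
    moreover have "c' 0 = 0" using c(2) by (simp add: c'_def)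
    moreover have "insert 0 (insert b A) = c' ` {..Suc N}"
    proof -
      have "c' ` {..Suc N} = insert (c' (Suc N)) (c' ` {..N})"
        by (simp add: atMost_Suc)
      also have "c' ` {..N} = c ` {..N}" by (intro image_cong) (auto simp: c'_def)
      finally show ?thesis using c(3) by (auto simp: c'_def)
    qed
    ultimately show ?case by blast
  qed
  then show thesis using that by blast
qed

lemma levy_sheet_prob_space: "levy_sheet M L \<Psi> \<Longrightarrow> prob_space M"
  by (simp add: levy_sheet_def)

lemma levy_sheet_measurable:
  "levy_sheet M L \<Psi> \<Longrightarrow> 0 \<le> s \<Longrightarrow> 0 \<le> t \<Longrightarrow> L s t \<in> borel_measurable M"
  by (auto simp: levy_sheet_def)

lemma measure_rect_set:
  assumes "s \<le> s'" "t \<le> t'"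
  shows "measure lborel (rect_set ((s, t), (s', t'))) = (s' - s) * (t' - t)"
proof -
  have "emeasure lborel (rect_set ((s, t), (s', t'))) = ennreal ((s' - s) * (t' - t))"
    using assms unfolding rect_set_def lborel_prod[symmetric]
    by (simp add: lborel.emeasure_pair_measure_Times ennreal_mult)
  then show ?thesis using assms by (simp add: measure_def)
qed

text \<open>The sheet at a grid point is the sum of its increments over the cells below and to the left of
  that point, because the sheet vanishes on the axes. In the linear combination the cell \<open>(p, q)\<close>
  therefore carries the coefficient \<open>\<Sum>\<^sub>i \<xi>\<^sub>i [p < k\<^sub>i, q < l\<^sub>i]\<close>, and independence turns the characteristic
  function into a product over the cells. The factor \<open>r\<close> is the scaling \<open>\<surd>n\<close> of the kernels.\<close>
lemma levy_sheet_grid_char: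
  fixes L :: "real \<Rightarrow> real \<Rightarrow> 'a \<Rightarrow> real" and \<xi> :: "'i \<Rightarrow> real"
  assumes L: "levy_sheet M L \<Psi>" and r: "0 < r"
    and c: "strict_mono c" "c 0 = 0" and d: "strict_mono d" "d 0 = 0"
    and kl: "\<And>i. i \<in> I \<Longrightarrow> k i \<le> N \<and> l i \<le> N'"
  shows "(\<integral>\<omega>. iexp (\<Sum>i\<in>I. \<xi> i * L (r * c (k i)) (r * d (l i)) \<omega>) \<partial>M)
    = (\<Prod>(p, q)\<in>{..<N} \<times> {..<N'}.
        exp (- complex_of_real (r\<^sup>2 * (c (Suc p) - c p) * (d (Suc q) - d q))
          * \<Psi> (\<Sum>i\<in>I. \<xi> i * of_bool (p < k i \<and> q < l i))))"
proof -
  interpret prob_space M using L by (rule levy_sheet_prob_space)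
  have [measurable]: "L s t \<in> borel_measurable M" if "0 \<le> s" "0 \<le> t" for s t
    using levy_sheet_measurable[OF L] that .
  have c0: "0 \<le> c j" and d0: "0 \<le> d j" for j
    using c d strict_mono_less_eq[of c 0 j] strict_mono_less_eq[of d 0 j] by auto
  define Q where "Q = (\<lambda>(p, q). ((r * c p, r * d q), (r * c (Suc p), r * d (Suc q))))"
  define \<phi> where "\<phi> = (\<lambda>(p, q). \<Sum>i\<in>I. \<xi> i * of_bool (p < k i \<and> q < l i))"
  let ?G = "{..<N} \<times> {..<N'}"
  have rectQ: "is_rect (Q g)" for g
    using r c0 d0 strict_monoD[OF c(1) lessI] strict_monoD[OF d(1) lessI]
    by (auto simp: Q_def is_rect_def split: prod.split)
  have injQ: "inj_on Q A" for A
    using r strict_mono_eq[OF c(1)] strict_mono_eq[OF d(1)] by (auto simp: inj_on_def Q_def)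
  have sheet_meas [measurable]: "sheet_incr L (Q g) \<in> borel_measurable M" for g
    using r c0 d0 by (cases g) (auto simp: Q_def sheet_incr_def rect_incr_def)
  have cells: "p = p'" if "u \<in> {r * e p<..r * e (Suc p)}" "u \<in> {r * e p'<..r * e (Suc p')}" 
    "strict_mono e" for u p p' and e :: "nat \<Rightarrow> real"
  proof (rule ccontr)
    assume "p \<noteq> p'"
    then have "e (Suc p) \<le> e p' \<or> e (Suc p') \<le> e p"
      using that(3) by (metis Suc_leI nat_neq_iff strict_mono_less_eq)
    then have "r * e (Suc p) \<le> r * e p' \<or> r * e (Suc p') \<le> r * e p"
      using r by simp
    then show False using that by auto
  qed
  have "disjoint_family_on rect_set (Q ` ?G)"
    unfolding disjoint_family_on_def
  proof (intro ballI impI)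
    fix R R' assume "R \<in> Q ` ?G" "R' \<in> Q ` ?G" "R \<noteq> R'"
    then obtain p q p' q' where R: "R = Q (p, q)" "R' = Q (p', q')" "(p, q) \<noteq> (p', q')" by auto
    show "rect_set R \<inter> rect_set R' = {}"
      using cells[OF _ _ c(1), of _ p p'] cells[OF _ _ d(1), of _ q q'] R(3)
      unfolding R by (fastforce simp: Q_def rect_set_def)
  qed
  then have "indep_vars (\<lambda>_. borel) (sheet_incr L) (Q ` ?G)"
    using L rectQ by (auto simp: levy_sheet_def)
  \<comment> \<open>Independence is indexed by rectangles and the coefficients by cells, hence the inverse of \<open>Q\<close>.\<close>
  then have indep: "indep_vars (\<lambda>_. borel) (\<lambda>R \<omega>. iexp (\<phi> (the_inv_into ?G Q R) * sheet_incr L R \<omega>)) (Q ` ?G)"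
    by (rule indep_vars_compose2) measurable
  have boundary: "AE \<omega> in M. \<forall>j. L (r * c j) 0 \<omega> = 0 \<and> L 0 (r * d j) \<omega> = 0"
    unfolding AE_all_countable using L r c0 d0 by (auto simp: levy_sheet_def)
  have rect_sum: "(\<Sum>p<m. \<Sum>q<n. sheet_incr L (Q (p, q)) \<omega>) = L (r * c m) (r * d n) \<omega>"
    if "\<forall>j. L (r * c j) 0 \<omega> = 0 \<and> L 0 (r * d j) \<omega> = 0" for \<omega> m n
  proof -
    let ?f = "\<lambda>p q. L (r * c p) (r * d q) \<omega>"
    have "(\<Sum>q<n. sheet_incr L (Q (p, q)) \<omega>) = ?f (Suc p) n - ?f p n" for p
    proof -
      have "(\<Sum>q<n. sheet_incr L (Q (p, q)) \<omega>) = (\<Sum>q<n. (?f (Suc p) (Suc q) - ?f p (Suc q)) - (?f (Suc p) q - ?f p q))"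
        by (simp add: Q_def sheet_incr_def rect_incr_def algebra_simps)
      also have "\<dots> = ?f (Suc p) n - ?f p n"
        using that d(2) by (subst sum_lessThan_telescope) simp
      finally show ?thesis .
    qed
    then have "(\<Sum>p<m. \<Sum>q<n. sheet_incr L (Q (p, q)) \<omega>) = (\<Sum>p<m. ?f (Suc p) n - ?f p n)"
      by simp
    also have "\<dots> = ?f m n"
      using that c(2) by (subst sum_lessThan_telescope) simp
    finally show ?thesis .
  qed
  have expand: "(\<Sum>i\<in>I. \<xi> i * L (r * c (k i)) (r * d (l i)) \<omega>) = (\<Sum>g\<in>?G. \<phi> g * sheet_incr L (Q g) \<omega>)"
    if "\<forall>j. L (r * c j) 0 \<omega> = 0 \<and> L 0 (r * d j) \<omega> = 0" for \<omega>
  proof -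
    have "L (r * c (k i)) (r * d (l i)) \<omega>
        = (\<Sum>(p, q)\<in>?G. of_bool (p < k i \<and> q < l i) * sheet_incr L (Q (p, q)) \<omega>)" if "i \<in> I" for i
    proof -
      have "(\<Sum>(p, q)\<in>?G. of_bool (p < k i \<and> q < l i) * sheet_incr L (Q (p, q)) \<omega>)
        = (\<Sum>(p, q)\<in>{..<k i} \<times> {..<l i}. sheet_incr L (Q (p, q)) \<omega>)"
        using kl[OF \<open>i \<in> I\<close>] by (intro sum.mono_neutral_cong_right) auto
      then show ?thesis
        using rect_sum[OF \<open>\<forall>j. _ j\<close>] by (simp add: sum.cartesian_product)
    qed
    then have "(\<Sum>i\<in>I. \<xi> i * L (r * c (k i)) (r * d (l i)) \<omega>)
      = (\<Sum>i\<in>I. \<Sum>(p, q)\<in>?G. \<xi> i * of_bool (p < k i \<and> q < l i) * sheet_incr L (Q (p, q)) \<omega>)"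
      by (intro sum.cong refl) (simp only: sum_distrib_left case_prod_unfold mult.assoc)
    also have "\<dots> = (\<Sum>g\<in>?G. \<phi> g * sheet_incr L (Q g) \<omega>)"
      by (subst sum.swap) (simp only: \<phi>_def sum_distrib_right case_prod_unfold prod.collapse)
    finally show ?thesis .
  qed
  have "(\<integral>\<omega>. iexp (\<Sum>i\<in>I. \<xi> i * L (r * c (k i)) (r * d (l i)) \<omega>) \<partial>M)
    = (\<integral>\<omega>. iexp (\<Sum>g\<in>?G. \<phi> g * sheet_incr L (Q g) \<omega>) \<partial>M)"
  proof (rule integral_cong_AE)
    show "AE \<omega> in M. iexp (\<Sum>i\<in>I. \<xi> i * L (r * c (k i)) (r * d (l i)) \<omega>)
        = iexp (\<Sum>g\<in>?G. \<phi> g * sheet_incr L (Q g) \<omega>)"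
      using boundary by eventually_elim (drule expand, simp)
    have [measurable]: "L (r * c (k i)) (r * d (l i)) \<in> borel_measurable M" for i
      using r c0 d0 by auto
    show "(\<lambda>\<omega>. iexp (\<Sum>i\<in>I. \<xi> i * L (r * c (k i)) (r * d (l i)) \<omega>)) \<in> borel_measurable M"
      by measurable
  qed measurable
  also have "\<dots> = (\<integral>\<omega>. (\<Prod>R\<in>Q ` ?G. iexp (\<phi> (the_inv_into ?G Q R) * sheet_incr L R \<omega>)) \<partial>M)"
    by (simp add: prod.reindex[OF injQ] the_inv_into_f_f[OF injQ] sum_distrib_left exp_sum)
  also have "\<dots> = (\<Prod>R\<in>Q ` ?G. \<integral>\<omega>. iexp (\<phi> (the_inv_into ?G Q R) * sheet_incr L R \<omega>) \<partial>M)"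
    by (intro indep_vars_lebesgue_integral indep integrable_const_bound[where B = 1]) auto
  also have "\<dots> = (\<Prod>g\<in>?G. char (distr M borel (sheet_incr L (Q g))) (\<phi> g))"
    by (simp add: prod.reindex[OF injQ] the_inv_into_f_f[OF injQ] char_def integral_distr)
  also have "\<dots> = (\<Prod>(p, q)\<in>?G. exp (- complex_of_real (r\<^sup>2 * (c (Suc p) - c p) * (d (Suc q) - d q))
          * \<Psi> (\<phi> (p, q))))"
  proof (intro prod.cong refl)
    fix g assume "g \<in> ?G"
    obtain p q where g: "g = (p, q)" by (cases g)
    have "c p \<le> c (Suc p)" "d q \<le> d (Suc q)"
      using c d by (simp_all add: strict_mono_less_eq)
    then have "measure lborel (rect_set (Q g)) = (r * c (Suc p) - r * c p) * (r * d (Suc q) - r * d q)"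
      using r by (simp add: g Q_def measure_rect_set)
    then have "measure lborel (rect_set (Q g)) = r\<^sup>2 * (c (Suc p) - c p) * (d (Suc q) - d q)"
      by (simp add: power2_eq_square algebra_simps)
    moreover have "char (distr M borel (sheet_incr L (Q g))) (\<phi> g)
        = exp (- complex_of_real (measure lborel (rect_set (Q g))) * \<Psi> (\<phi> g))"
      using L rectQ[of g] unfolding levy_sheet_def by blast
    ultimately show "char (distr M borel (sheet_incr L (Q g))) (\<phi> g) =
      (case g of (p, q) \<Rightarrow> exp (- complex_of_real (r\<^sup>2 * (c (Suc p) - c p) * (d (Suc q) - d q)) * \<Psi> (\<phi> (p, q))))"
      by (simp only: g prod.case)
  qed
  finally show ?thesis by (simp add: \<phi>_def)
qed

text \<open>Both facts come from the increment over the unit square: a characteristic function has modulus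
  at most 1, and its value at \<open>- \<xi>\<close> is the conjugate of its value at \<open>\<xi>\<close>.\<close>
lemma levy_sheet_exponent:
  assumes L: "levy_sheet M L (\<lambda>\<xi>. complex_of_real (a \<xi>) + \<i> * complex_of_real (b \<xi>))"
  shows "0 \<le> a \<xi>" "a (- \<xi>) = a \<xi>"
proof -
  interpret prob_space M using L by (rule levy_sheet_prob_space)
  define Q :: rect where "Q = ((0, 0), (1, 1))"
  define D where "D = distr M borel (sheet_incr L Q)"
  have "measure lborel (rect_set Q) = 1"
    by (simp add: Q_def measure_rect_set)
  have char: "char D \<xi> = exp (- (complex_of_real (a \<xi>) + \<i> * complex_of_real (b \<xi>)))" for \<xi>
  proof -
    have "is_rect Q" by (simp add: Q_def is_rect_def)
    then have "char D \<xi> = exp (- complex_of_real (measure lborel (rect_set Q))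
        * (complex_of_real (a \<xi>) + \<i> * complex_of_real (b \<xi>)))"
      using L unfolding levy_sheet_def D_def by blast
    then show ?thesis by (simp only: \<open>measure lborel (rect_set Q) = 1\<close>) simp
  qed
  then have cmod: "cmod (char D \<xi>) = exp (- a \<xi>)" for \<xi>
    by (simp add: norm_exp_eq_Re)
  have "sheet_incr L Q \<in> borel_measurable M"
    using levy_sheet_measurable[OF L] by (auto simp: Q_def sheet_incr_def rect_incr_def)
  then interpret D: real_distribution D
    unfolding D_def by (rule real_distribution_distr)
  have "exp (- a \<xi>) \<le> 1" using D.cmod_char_le_1[of \<xi>] cmod by simp
  then show "0 \<le> a \<xi>" by simp
  have "char D (- \<xi>) = cnj (char D \<xi>)"
  proof -
    have "iexp (- \<xi> * x) = cnj (iexp (\<xi> * x))" for x by (simp add: exp_cnj)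
    then show ?thesis by (simp add: char_def)
  qed
  then have "exp (- a (- \<xi>)) = exp (- a \<xi>)" using cmod by (metis complex_mod_cnj)
  then show "a (- \<xi>) = a \<xi>" by simp
qed

lemma prod_exp_uminus_grid: "(\<Prod>(p, q)\<in>{..<N} \<times> {..<N'}. exp (- f p q)) = exp (- (\<Sum>p<N. \<Sum>q<N'. f p q :: real))"
  for N N' :: nat
  unfolding sum.cartesian_product by (subst sum_negf[symmetric], subst exp_sum) (simp_all add: case_prod_unfold)

text \<open>The coefficient \<open>\<phi>\<close> of a cell is a sum of signs over the points above and to the right of the cell,
  hence an odd integer when their number is odd; then the cell contributes at least \<open>\<alpha>\<close> times its
  area to the exponent. In the strip \<open>v \<le> T\<close>, which lies below all points, that number only depends on
  the first coordinate, so the odd cells there have total area \<open>T\<close> times the odd gap of the \<open>x i\<close>.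
  The strip \<open>u \<le> S\<close> gives \<open>S\<close> times the odd gap of the \<open>y i\<close>. No cell is counted twice: where
  the strips meet, all points count, and their number is even.\<close>
lemma levy_sheet_joint_char_le:
  fixes L :: "real \<Rightarrow> real \<Rightarrow> 'a \<Rightarrow> real" and \<epsilon> :: "'i \<Rightarrow> int"
  assumes L: "levy_sheet M L (\<lambda>\<xi>. complex_of_real (a \<xi>) + \<i> * complex_of_real (b \<xi>))"
    and r: "0 < r" and I: "finite I" "card I = 2 * n"
    and S: "0 < S" "\<And>i. i \<in> I \<Longrightarrow> S \<le> x i" and T: "0 < T" "\<And>i. i \<in> I \<Longrightarrow> T \<le> y i"
    and \<epsilon>: "\<And>i. i \<in> I \<Longrightarrow> \<epsilon> i \<in> {1, -1}"
    and \<alpha>: "\<And>j. j \<in> {1..card I} \<Longrightarrow> \<alpha> \<le> a (real j * \<theta>)"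
  shows "cmod (\<integral>\<omega>. iexp (\<Sum>i\<in>I. \<theta> * of_int (\<epsilon> i) * L (r * x i) (r * y i) \<omega>) \<partial>M)
    \<le> pairing_weight (r\<^sup>2 * \<alpha> * T) n I x * pairing_weight (r\<^sup>2 * \<alpha> * S) n I y"
proof -
  have posS: "insert S (x ` I) \<subseteq> {0<..}" and posT: "insert T (y ` I) \<subseteq> {0<..}"
    using less_le_trans[OF S(1) S(2)] less_le_trans[OF T(1) T(2)] S(1) T(1) by auto
  have finS: "finite (insert S (x ` I))" and finT: "finite (insert T (y ` I))"
    using I(1) by simp_all
  obtain c :: "nat \<Rightarrow> real" and N where c: "strict_mono c" "c 0 = 0" and cA: "insert S (x ` I) \<subseteq> c ` {..N}"
    by (rule ex_grid[OF finS posS])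
  obtain d :: "nat \<Rightarrow> real" and N' where d: "strict_mono d" "d 0 = 0" and dA: "insert T (y ` I) \<subseteq> d ` {..N'}"
    by (rule ex_grid[OF finT posT])
  have "\<forall>i\<in>I. \<exists>j. j \<le> N \<and> x i = c j" using cA by auto
  then obtain k where k: "\<And>i. i \<in> I \<Longrightarrow> k i \<le> N" "\<And>i. i \<in> I \<Longrightarrow> x i = c (k i)" by metis
  have "\<forall>i\<in>I. \<exists>j. j \<le> N' \<and> y i = d j" using dA by auto
  then obtain l where l: "\<And>i. i \<in> I \<Longrightarrow> l i \<le> N'" "\<And>i. i \<in> I \<Longrightarrow> y i = d (l i)" by metis
  obtain p0 where p0: "p0 \<le> N" "S = c p0" using cA by auto
  obtain q0 where q0: "q0 \<le> N'" "T = d q0" using dA by auto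
  have pk: "p0 \<le> k i" if "i \<in> I" for i
    using S(2)[OF that] k(2)[OF that] p0 c(1) by (simp add: strict_mono_less_eq)
  have ql: "q0 \<le> l i" if "i \<in> I" for i
    using T(2)[OF that] l(2)[OF that] q0 d(1) by (simp add: strict_mono_less_eq)
  define \<phi> where "\<phi> p q = (\<Sum>i\<in>I. \<epsilon> i * of_bool (p < k i \<and> q < l i))" for p q
  define \<Delta> where "\<Delta> e j = (e (Suc j) - e j :: real)" for e j
  have \<Delta>: "0 \<le> \<Delta> c j" "0 \<le> \<Delta> d j" for j
    using c(1) d(1) by (simp_all add: \<Delta>_def strict_mono_less_eq)
  note a_nonneg = levy_sheet_exponent(1)[OF L]
  have even_fun: "a (\<theta> * of_int z) = a (\<theta> * of_int \<bar>z\<bar>)" for z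
    using levy_sheet_exponent(2)[OF L, of "\<theta> * of_int z"] by (cases "0 \<le> z") auto
  have odd_coeff: "odd (\<phi> p q) \<longleftrightarrow> odd (card {i \<in> I. p < k i \<and> q < l i})" for p q
  proof -
    have "{i \<in> I. odd (\<epsilon> i * of_bool (p < k i \<and> q < l i))} = {i \<in> I. p < k i \<and> q < l i}"
      using \<epsilon> by fastforce
    then show ?thesis unfolding \<phi>_def by (simp only: even_sum_iff[OF I(1)])
  qed
  have \<phi>_le: "\<bar>\<phi> p q\<bar> \<le> int (card I)" for p q
  proof -
    have "\<bar>\<phi> p q\<bar> \<le> (\<Sum>i\<in>I. \<bar>\<epsilon> i * of_bool (p < k i \<and> q < l i)\<bar>)"
      unfolding \<phi>_def by (rule sum_abs)
    also have "\<dots> \<le> (\<Sum>i\<in>I. 1)" using \<epsilon> by (intro sum_mono) fastforce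
    finally show ?thesis by simp
  qed
  have cell_odd: "\<alpha> \<le> a (\<theta> * of_int (\<phi> p q))" if "odd (\<phi> p q)" for p q
  proof -
    have "nat \<bar>\<phi> p q\<bar> \<in> {1..card I}" using that \<phi>_le[of p q] by (cases "\<phi> p q = 0") auto
    from \<alpha>[OF this] show ?thesis by (simp add: even_fun[of "\<phi> p q"] mult.commute)
  qed
  \<comment> \<open>Lower bound for one cell: the first term is the strip below height \<open>T\<close>, the second one the
    strip to the left of \<open>S\<close>.\<close>
  have cell: "\<alpha> * (of_bool (q < q0) * of_bool (odd (card {i \<in> I. p < k i}))
      + of_bool (p < p0) * of_bool (odd (card {i \<in> I. q < l i}))) \<le> a (\<theta> * of_int (\<phi> p q))"
    (is "?l \<le> _") for p q
  proof -
    show ?thesis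
    proof (cases "q < q0 \<and> odd (card {i \<in> I. p < k i})")
      case x: True
      have "\<not> p < p0"
      proof
        assume "p < p0"
        then have "{i \<in> I. p < k i} = I" using pk by fastforce
        then show False using x I(2) by simp
      qed
      have "{i \<in> I. p < k i \<and> q < l i} = {i \<in> I. p < k i}" using ql x by fastforce
      then have "odd (\<phi> p q)" using x odd_coeff by simp
      then show ?thesis using cell_odd x \<open>\<not> p < p0\<close> by simp
    next
      case not_x: False
      show ?thesis
      proof (cases "p < p0 \<and> odd (card {i \<in> I. q < l i})")
        case y: True
        have "{i \<in> I. p < k i \<and> q < l i} = {i \<in> I. q < l i}" using pk y by fastforce
        then have "odd (\<phi> p q)" using y odd_coeff by simp
        moreover have "of_bool (q < q0) * of_bool (odd (card {i \<in> I. p < k i})) = (0 :: real)"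
          using not_x by auto
        ultimately show ?thesis using cell_odd y by simp
      next
        case not_y: False
        have "of_bool (q < q0) * of_bool (odd (card {i \<in> I. p < k i})) = (0 :: real)"
          "of_bool (p < p0) * of_bool (odd (card {i \<in> I. q < l i})) = (0 :: real)"
          using not_x not_y by auto
        then show ?thesis using a_nonneg by simp
      qed
    qed
  qed
  define E where "E = (\<Sum>p<N. \<Sum>q<N'. r\<^sup>2 * \<Delta> c p * \<Delta> d q * a (\<theta> * of_int (\<phi> p q)))"
  have width: "(\<Sum>q<N'. \<Delta> d q * of_bool (q < q0)) = T" "(\<Sum>p<N. \<Delta> c p * of_bool (p < p0)) = S"
  proof -
    have "(\<Sum>q<N'. \<Delta> d q * of_bool (q < q0)) = (\<Sum>q<q0. \<Delta> d q)"
      using q0 by (intro sum.mono_neutral_cong_right) auto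
    then show "(\<Sum>q<N'. \<Delta> d q * of_bool (q < q0)) = T"
      using q0 d(2) by (simp add: \<Delta>_def sum_lessThan_telescope)
    have "(\<Sum>p<N. \<Delta> c p * of_bool (p < p0)) = (\<Sum>p<p0. \<Delta> c p)"
      using p0 by (intro sum.mono_neutral_cong_right) auto
    then show "(\<Sum>p<N. \<Delta> c p * of_bool (p < p0)) = S"
      using p0 c(2) by (simp add: \<Delta>_def sum_lessThan_telescope)
  qed
  have "r\<^sup>2 * \<alpha> * (T * odd_gap c N I k + S * odd_gap d N' I l)
    = (\<Sum>p<N. \<Sum>q<N'. r\<^sup>2 * \<Delta> c p * \<Delta> d q * (\<alpha> * (of_bool (q < q0) * of_bool (odd (card {i \<in> I. p < k i}))
      + of_bool (p < p0) * of_bool (odd (card {i \<in> I. q < l i})))))"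
  proof -
    have "(\<Sum>p<N. \<Sum>q<N'. r\<^sup>2 * \<Delta> c p * \<Delta> d q * (\<alpha> * (u q * v p + u' p * v' q)))
      = r\<^sup>2 * \<alpha> * ((\<Sum>p<N. \<Delta> c p * v p) * (\<Sum>q<N'. \<Delta> d q * u q)
        + (\<Sum>p<N. \<Delta> c p * u' p) * (\<Sum>q<N'. \<Delta> d q * v' q))" for u v u' v' :: "nat \<Rightarrow> real"
      unfolding sum_product unfolding sum_distrib_left sum.distrib[symmetric]
      by (intro sum.cong refl) (simp add: algebra_simps)
    note factor = this
    have gap: "odd_gap c N I k = (\<Sum>p<N. \<Delta> c p * of_bool (odd (card {i \<in> I. p < k i})))"
      "odd_gap d N' I l = (\<Sum>q<N'. \<Delta> d q * of_bool (odd (card {i \<in> I. q < l i})))"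
      by (simp_all only: odd_gap_def \<Delta>_def)
    have swap: "r\<^sup>2 * \<alpha> * (X * Y + V) = r\<^sup>2 * \<alpha> * (Y * X + V)" for X Y V
      by (simp add: mult.commute)
    show ?thesis
      unfolding gap width[symmetric] by (rule trans[OF swap factor[symmetric]])
  qed
  also have "\<dots> \<le> E"
    unfolding E_def using \<Delta> by (intro sum_mono mult_left_mono cell) auto
  finally have E: "r\<^sup>2 * \<alpha> * (T * odd_gap c N I k + S * odd_gap d N' I l) \<le> E" .
  have "(\<integral>\<omega>. iexp (\<Sum>i\<in>I. \<theta> * of_int (\<epsilon> i) * L (r * x i) (r * y i) \<omega>) \<partial>M)
    = (\<integral>\<omega>. iexp (\<Sum>i\<in>I. \<theta> * of_int (\<epsilon> i) * L (r * c (k i)) (r * d (l i)) \<omega>) \<partial>M)"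
    using k l by (simp cong: sum.cong)
  also have "\<dots> = (\<Prod>(p, q)\<in>{..<N} \<times> {..<N'}. exp (- complex_of_real (r\<^sup>2 * (c (Suc p) - c p) * (d (Suc q) - d q))
          * (complex_of_real (a (\<Sum>i\<in>I. \<theta> * of_int (\<epsilon> i) * of_bool (p < k i \<and> q < l i)))
            + \<i> * complex_of_real (b (\<Sum>i\<in>I. \<theta> * of_int (\<epsilon> i) * of_bool (p < k i \<and> q < l i))))))"
    by (rule levy_sheet_grid_char[OF L r c d]) (use k l in auto)
  finally have "cmod (\<integral>\<omega>. iexp (\<Sum>i\<in>I. \<theta> * of_int (\<epsilon> i) * L (r * x i) (r * y i) \<omega>) \<partial>M)
    = cmod (\<Prod>(p, q)\<in>{..<N} \<times> {..<N'}. exp (- complex_of_real (r\<^sup>2 * (c (Suc p) - c p) * (d (Suc q) - d q))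
          * (complex_of_real (a (\<Sum>i\<in>I. \<theta> * of_int (\<epsilon> i) * of_bool (p < k i \<and> q < l i)))
            + \<i> * complex_of_real (b (\<Sum>i\<in>I. \<theta> * of_int (\<epsilon> i) * of_bool (p < k i \<and> q < l i))))))"
    by (rule arg_cong)
  also have "\<dots> = (\<Prod>(p, q)\<in>{..<N} \<times> {..<N'}. exp (- (r\<^sup>2 * \<Delta> c p * \<Delta> d q * a (\<theta> * of_int (\<phi> p q)))))"
  proof -
    have "(\<Sum>i\<in>I. \<theta> * of_int (\<epsilon> i) * of_bool (p < k i \<and> q < l i)) = \<theta> * of_int (\<phi> p q)" for p q
      by (simp only: \<phi>_def sum_distrib_left of_int_sum of_int_mult of_int_of_bool mult.assoc)
    then show ?thesis
      unfolding prod_norm[symmetric]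
      by (intro prod.cong refl) (simp add: case_prod_unfold norm_exp_eq_Re \<Delta>_def)
  qed
  also have "\<dots> = exp (- E)"
    unfolding E_def by (rule prod_exp_uminus_grid)
  also have "\<dots> \<le> exp (- (r\<^sup>2 * \<alpha> * T) * odd_gap c N I k) * exp (- (r\<^sup>2 * \<alpha> * S) * odd_gap d N' I l)"
  proof -
    have "- E \<le> - (r\<^sup>2 * \<alpha> * T) * odd_gap c N I k + - (r\<^sup>2 * \<alpha> * S) * odd_gap d N' I l"
      using E by (simp only: ring_distribs mult.assoc) simp
    then show ?thesis by (simp only: mult_exp_exp exp_le_cancel_iff)
  qed
  also have "\<dots> \<le> pairing_weight (r\<^sup>2 * \<alpha> * T) n I (\<lambda>i. c (k i)) * pairing_weight (r\<^sup>2 * \<alpha> * S) n I (\<lambda>i. d (l i))"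
    using I k(1) l(1) strict_mono_mono[OF c(1)] strict_mono_mono[OF d(1)]
    by (intro mult_mono exp_odd_gap_le_pairing_weight) (auto simp: pairing_weight_nonneg)
  also have "pairing_weight (r\<^sup>2 * \<alpha> * T) n I (\<lambda>i. c (k i)) = pairing_weight (r\<^sup>2 * \<alpha> * T) n I x"
    using k by (intro pairing_weight_cong) simp
  also have "pairing_weight (r\<^sup>2 * \<alpha> * S) n I (\<lambda>i. d (l i)) = pairing_weight (r\<^sup>2 * \<alpha> * S) n I y"
    using l by (intro pairing_weight_cong) simp
  finally show ?thesis .
qed

section \<open>Mixed trigonometric moments\<close>

lemma trig_as_exponentials:
  assumes "trig \<in> {cos, sin :: real \<Rightarrow> real}"
  obtains w :: "int \<Rightarrow> complex" where "\<And>\<epsilon>. \<epsilon> \<in> {1, -1} \<Longrightarrow> cmod (w \<epsilon>) = 1 / 2"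
    "\<And>z. complex_of_real (trig z) = (\<Sum>\<epsilon>\<in>{1, -1}. w \<epsilon> * iexp (of_int \<epsilon> * z))"
proof (cases "trig = cos")
  case True
  show thesis
    by (rule that[of "\<lambda>_. 1 / 2"]) (auto simp: True complex_eq_iff Re_exp Im_exp)
next
  case False
  then have [simp]: "trig = sin" using assms by simp
  show thesis
    by (rule that[of "\<lambda>\<epsilon>. - \<i> * of_int \<epsilon> / 2"]) (auto simp: complex_eq_iff Re_exp Im_exp norm_divide norm_mult)
qed

text \<open>Each factor is a combination of \<open>2\<close> exponentials with weights of modulus \<open>1 / 2\<close>. The product
  is then a combination of \<open>2^card I\<close> exponentials, one for each choice of signs, whose weights have
  total modulus 1; all of them obey the same bound.\<close>
lemma levy_sheet_trig_moment_le:
  fixes L :: "real \<Rightarrow> real \<Rightarrow> 'a \<Rightarrow> real"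
  assumes L: "levy_sheet M L (\<lambda>\<xi>. complex_of_real (a \<xi>) + \<i> * complex_of_real (b \<xi>))"
    and r: "0 < r" and I: "finite I" "card I = 2 * n"
    and S: "0 < S" "\<And>i. i \<in> I \<Longrightarrow> S \<le> x i" and T: "0 < T" "\<And>i. i \<in> I \<Longrightarrow> T \<le> y i"
    and \<alpha>: "\<And>j. j \<in> {1..card I} \<Longrightarrow> \<alpha> \<le> a (real j * \<theta>)"
    and trig: "trig \<in> {cos, sin}"
  shows "\<bar>\<integral>\<omega>. (\<Prod>i\<in>I. trig (\<theta> * L (r * x i) (r * y i) \<omega>)) \<partial>M\<bar>
    \<le> pairing_weight (r\<^sup>2 * \<alpha> * T) n I x * pairing_weight (r\<^sup>2 * \<alpha> * S) n I y" (is "_ \<le> ?B")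
proof -
  interpret prob_space M using L by (rule levy_sheet_prob_space)
  have L_meas: "L s t \<in> borel_measurable M" if "0 \<le> s" "0 \<le> t" for s t
    using levy_sheet_measurable[OF L] that .
  have [measurable]: "L (r * x i) (r * y i) \<in> borel_measurable M" if "i \<in> I" for i
    using S(1) S(2)[OF that] T(1) T(2)[OF that] r by (intro L_meas) auto
  obtain w where w: "\<And>\<epsilon>. \<epsilon> \<in> {1, -1} \<Longrightarrow> cmod (w \<epsilon>) = 1 / 2"
    "\<And>z. complex_of_real (trig z) = (\<Sum>\<epsilon>\<in>{1, -1}. w \<epsilon> * iexp (of_int \<epsilon> * z))"
    using trig_as_exponentials[OF trig] by blast
  define E where "E = (I \<rightarrow>\<^sub>E {1, -1 :: int})"
  have E: "finite E" "card E = 2 ^ card I"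
    using I(1) by (auto simp: E_def finite_PiE card_PiE numeral_2_eq_2)
  define J where "J \<epsilon> \<omega> = iexp (\<Sum>i\<in>I. \<theta> * of_int (\<epsilon> i) * L (r * x i) (r * y i) \<omega>)" for \<epsilon> :: "'b \<Rightarrow> int" and \<omega>
  have [measurable]: "J \<epsilon> \<in> borel_measurable M" for \<epsilon>
    unfolding J_def by measurable
  have J_int: "integrable M (J \<epsilon>)" for \<epsilon>
    by (intro integrable_const_bound[where B = 1]) (auto simp: J_def)
  have expand: "complex_of_real (\<Prod>i\<in>I. trig (\<theta> * L (r * x i) (r * y i) \<omega>)) = (\<Sum>\<epsilon>\<in>E. (\<Prod>i\<in>I. w (\<epsilon> i)) * J \<epsilon> \<omega>)" for \<omega>
  proof -
    have "complex_of_real (\<Prod>i\<in>I. trig (\<theta> * L (r * x i) (r * y i) \<omega>))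
      = (\<Prod>i\<in>I. \<Sum>\<epsilon>\<in>{1, -1}. w \<epsilon> * iexp (of_int \<epsilon> * (\<theta> * L (r * x i) (r * y i) \<omega>)))"
      unfolding of_real_prod w(2) ..
    also have "\<dots> = (\<Sum>\<epsilon>\<in>E. \<Prod>i\<in>I. w (\<epsilon> i) * iexp (of_int (\<epsilon> i) * (\<theta> * L (r * x i) (r * y i) \<omega>)))"
      unfolding E_def using I(1) by (intro prod_sum_PiE) auto
    also have "\<dots> = (\<Sum>\<epsilon>\<in>E. (\<Prod>i\<in>I. w (\<epsilon> i)) * J \<epsilon> \<omega>)"
      using I(1) by (simp add: J_def prod.distrib exp_sum sum_distrib_left ac_simps)
    finally show ?thesis .
  qed
  have "\<bar>\<integral>\<omega>. (\<Prod>i\<in>I. trig (\<theta> * L (r * x i) (r * y i) \<omega>)) \<partial>M\<bar>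
    = cmod (\<integral>\<omega>. complex_of_real (\<Prod>i\<in>I. trig (\<theta> * L (r * x i) (r * y i) \<omega>)) \<partial>M)"
    unfolding integral_complex_of_real by simp
  also have "\<dots> = cmod (\<Sum>\<epsilon>\<in>E. (\<Prod>i\<in>I. w (\<epsilon> i)) * (\<integral>\<omega>. J \<epsilon> \<omega> \<partial>M))"
    unfolding expand using J_int by (simp add: Bochner_Integration.integral_sum)
  also have "\<dots> \<le> (\<Sum>\<epsilon>\<in>E. cmod ((\<Prod>i\<in>I. w (\<epsilon> i)) * (\<integral>\<omega>. J \<epsilon> \<omega> \<partial>M)))"
    by (rule norm_sum)
  also have "\<dots> \<le> (\<Sum>\<epsilon>\<in>E. (1 / 2) ^ card I * ?B)"
  proof (intro sum_mono)
    fix \<epsilon> assume "\<epsilon> \<in> E"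
    then have \<epsilon>: "\<epsilon> i \<in> {1, -1}" if "i \<in> I" for i using that by (auto simp: E_def)
    have "cmod (\<Prod>i\<in>I. w (\<epsilon> i)) = (1 / 2) ^ card I"
    proof -
      have "cmod (\<Prod>i\<in>I. w (\<epsilon> i)) = (\<Prod>i\<in>I. cmod (w (\<epsilon> i)))" by (simp add: prod_norm)
      also have "\<dots> = (\<Prod>i\<in>I. 1 / 2)" using w(1)[OF \<epsilon>] by (intro prod.cong refl)
      finally show ?thesis by simp
    qed
    moreover have "cmod (\<integral>\<omega>. J \<epsilon> \<omega> \<partial>M) \<le> ?B"
      unfolding J_def by (rule levy_sheet_joint_char_le[OF L r I S T \<epsilon> \<alpha>])
    ultimately show "cmod ((\<Prod>i\<in>I. w (\<epsilon> i)) * (\<integral>\<omega>. J \<epsilon> \<omega> \<partial>M)) \<le> (1 / 2) ^ card I * ?B"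
      by (simp add: norm_mult mult_left_mono)
  qed
  also have "\<dots> = ?B" by (simp add: E power_divide)
  finally show ?thesis .
qed

section \<open>Moments of random double integrals\<close>

lemma finite_measure_PiM:
  assumes "finite_measure \<mu>" "finite I"
  shows "finite_measure (Pi\<^sub>M I (\<lambda>_. \<mu>))"
proof -
  interpret \<mu>: finite_measure \<mu> by fact
  interpret product_sigma_finite "\<lambda>_. \<mu>" by unfold_locales
  have "emeasure (Pi\<^sub>M I (\<lambda>_. \<mu>)) (space (Pi\<^sub>M I (\<lambda>_. \<mu>))) = (\<Prod>i\<in>I. emeasure \<mu> (space \<mu>))"
    using assms(2) by (simp add: space_PiM emeasure_PiM)
  also have "\<dots> \<noteq> \<infinity>" using \<mu>.emeasure_finite by (simp add: power_eq_top_ennreal)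
  finally show ?thesis by (rule finite_measureI)
qed

text \<open>The power of the double integral is an integral over \<open>card I\<close> copies of each variable. Taking the
  expectation inside is harmless since everything is bounded and the measures are finite. The
  assumption \<open>joint\<close> separates the \<open>x\<close> variables from the \<open>y\<close> variables, which need not be paired
  in the same way.\<close>
lemma moment_of_double_integral_le:
  fixes \<mu> \<nu> :: "real measure" and Z :: "real \<Rightarrow> real \<Rightarrow> 'a \<Rightarrow> real" and I :: "'i set"
  assumes "prob_space M" "finite_measure \<mu>" "finite_measure \<nu>"
    and Z: "(\<lambda>((x, y), \<omega>). Z x y \<omega>) \<in> borel_measurable ((\<mu> \<Otimes>\<^sub>M \<nu>) \<Otimes>\<^sub>M M)"
    and Z_le: "\<And>x y \<omega>. \<bar>Z x y \<omega>\<bar> \<le> 1" and I: "finite I"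
    and joint: "\<And>x y. \<bar>\<integral>\<omega>. (\<Prod>i\<in>I. Z (x i) (y i) \<omega>) \<partial>M\<bar> \<le> A x * B y"
    and A: "\<And>x. 0 \<le> A x" "A \<in> borel_measurable (Pi\<^sub>M I (\<lambda>_. \<mu>))"
    and B: "\<And>y. 0 \<le> B y" "B \<in> borel_measurable (Pi\<^sub>M I (\<lambda>_. \<nu>))"
  shows "ennreal \<bar>\<integral>\<omega>. (\<integral>x. \<integral>y. Z x y \<omega> \<partial>\<nu> \<partial>\<mu>) ^ card I \<partial>M\<bar>
    \<le> (\<integral>\<^sup>+x. A x \<partial>Pi\<^sub>M I (\<lambda>_. \<mu>)) * (\<integral>\<^sup>+y. B y \<partial>Pi\<^sub>M I (\<lambda>_. \<nu>))"
proof -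
  interpret prob_space M by fact
  interpret \<mu>: finite_measure \<mu> by fact
  interpret \<nu>: finite_measure \<nu> by fact
  interpret p\<mu>: product_sigma_finite "\<lambda>_::'i. \<mu>" by unfold_locales
  interpret p\<nu>: product_sigma_finite "\<lambda>_::'i. \<nu>" by unfold_locales
  define P where "P = Pi\<^sub>M I (\<lambda>_. \<mu>)"
  define Q where "Q = Pi\<^sub>M I (\<lambda>_. \<nu>)"
  interpret P: finite_measure P unfolding P_def by (rule finite_measure_PiM) fact+
  interpret Q: finite_measure Q unfolding Q_def by (rule finite_measure_PiM) fact+
  interpret PQ: pair_sigma_finite P Q by unfold_locales
  interpret PQ: finite_measure "P \<Otimes>\<^sub>M Q" by (rule finite_measure_pair_measure) unfold_locales
  interpret PQM: pair_sigma_finite "P \<Otimes>\<^sub>M Q" M by unfold_locales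
  interpret PQM: finite_measure "(P \<Otimes>\<^sub>M Q) \<Otimes>\<^sub>M M" by (rule finite_measure_pair_measure) unfold_locales
  note Z[measurable]
  have sec_y [measurable]: "(\<lambda>y. Z x y \<omega>) \<in> borel_measurable \<nu>" if "x \<in> space \<mu>" "\<omega> \<in> space M" for x \<omega>
    using measurable_compose[OF _ Z, of "\<lambda>y. ((x, y), \<omega>)" \<nu>] that by simp
  have Zx: "(\<lambda>p. Z (fst p) (snd p) \<omega>) \<in> borel_measurable (\<mu> \<Otimes>\<^sub>M \<nu>)" if "\<omega> \<in> space M" for \<omega>
    using measurable_compose[OF _ Z, of "\<lambda>p. (p, \<omega>)" "\<mu> \<Otimes>\<^sub>M \<nu>"] that by (simp add: case_prod_unfold)
  have int_y: "integrable \<nu> (\<lambda>y. Z x y \<omega>)" if "x \<in> space \<mu>" "\<omega> \<in> space M" for x \<omega>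
    by (intro \<nu>.integrable_const_bound[where B = 1] sec_y that) (use Z_le in auto)
  have int_x: "integrable \<mu> (\<lambda>x. \<integral>y. Z x y \<omega> \<partial>\<nu>)" if "\<omega> \<in> space M" for \<omega>
  proof (intro \<mu>.integrable_const_bound[where B = "measure \<nu> (space \<nu>)"] AE_I2)
    show "(\<lambda>x. \<integral>y. Z x y \<omega> \<partial>\<nu>) \<in> borel_measurable \<mu>"
      using Zx[OF that] by (intro \<nu>.borel_measurable_lebesgue_integral) (simp add: case_prod_unfold)
    show "norm (\<integral>y. Z x y \<omega> \<partial>\<nu>) \<le> measure \<nu> (space \<nu>)" if "x \<in> space \<mu>" for x
    proof -
      have "norm (\<integral>y. Z x y \<omega> \<partial>\<nu>) \<le> (\<integral>y. 1 \<partial>\<nu>)"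
        by (rule Bochner_Integration.integral_norm_bound_integral) (use Z_le int_y that \<open>\<omega> \<in> space M\<close> in auto)
      then show ?thesis by simp
    qed
  qed
  define F where "F p \<omega> = (\<Prod>i\<in>I. Z (fst p i) (snd p i) \<omega>)" for p \<omega>
  have F_le: "\<bar>F p \<omega>\<bar> \<le> 1" for p \<omega>
    unfolding F_def abs_prod using Z_le by (intro prod_le_1) auto
  have F_meas: "case_prod F \<in> borel_measurable ((P \<Otimes>\<^sub>M Q) \<Otimes>\<^sub>M M)"
    unfolding F_def case_prod_unfold
  proof (rule borel_measurable_prod)
    fix i assume "i \<in> I"
    then have [measurable]: "(\<lambda>x. x i) \<in> measurable P \<mu>" "(\<lambda>y. y i) \<in> measurable Q \<nu>"
      by (auto simp: P_def Q_def)
    have "(\<lambda>z. (((fst (fst z)) i, (snd (fst z)) i), snd z)) \<in> measurable ((P \<Otimes>\<^sub>M Q) \<Otimes>\<^sub>M M) ((\<mu> \<Otimes>\<^sub>M \<nu>) \<Otimes>\<^sub>M M)"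
      by measurable
    from measurable_compose[OF this Z]
    show "(\<lambda>z. Z (fst (fst z) i) (snd (fst z) i) (snd z)) \<in> borel_measurable ((P \<Otimes>\<^sub>M Q) \<Otimes>\<^sub>M M)"
      by simp
  qed
  have F_int: "integrable ((P \<Otimes>\<^sub>M Q) \<Otimes>\<^sub>M M) (case_prod F)"
    by (intro PQM.integrable_const_bound[where B = 1] F_meas) (use F_le in auto)
  have F_sec: "integrable (P \<Otimes>\<^sub>M Q) (\<lambda>p. F p \<omega>)" if "\<omega> \<in> space M" for \<omega>
  proof (intro PQ.integrable_const_bound[where B = 1])
    show "(\<lambda>p. F p \<omega>) \<in> borel_measurable (P \<Otimes>\<^sub>M Q)"
      using measurable_compose[OF _ F_meas, of "\<lambda>p. (p, \<omega>)"] that by simp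
  qed (use F_le in auto)
  have power: "(\<integral>x. \<integral>y. Z x y \<omega> \<partial>\<nu> \<partial>\<mu>) ^ card I = (\<integral>p. F p \<omega> \<partial>(P \<Otimes>\<^sub>M Q))"
    if \<omega>: "\<omega> \<in> space M" for \<omega>
  proof -
    have "(\<integral>x. \<integral>y. Z x y \<omega> \<partial>\<nu> \<partial>\<mu>) ^ card I = (\<integral>x. (\<Prod>i\<in>I. \<integral>y. Z (x i) y \<omega> \<partial>\<nu>) \<partial>P)"
      unfolding P_def using I int_x[OF \<omega>] by (subst p\<mu>.product_integral_prod) auto
    also have "\<dots> = (\<integral>x. \<integral>y. F (x, y) \<omega> \<partial>Q \<partial>P)"
    proof (rule Bochner_Integration.integral_cong[OF refl])
      fix x assume "x \<in> space P"
      then have "x i \<in> space \<mu>" if "i \<in> I" for i using that by (auto simp: P_def space_PiM PiE_iff)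
      then have "(\<integral>y. (\<Prod>i\<in>I. Z (x i) (y i) \<omega>) \<partial>Q) = (\<Prod>i\<in>I. \<integral>y. Z (x i) y \<omega> \<partial>\<nu>)"
        unfolding Q_def using I int_y \<omega> by (intro p\<nu>.product_integral_prod) auto
      then show "(\<Prod>i\<in>I. \<integral>y. Z (x i) y \<omega> \<partial>\<nu>) = (\<integral>y. F (x, y) \<omega> \<partial>Q)"
        by (simp add: F_def)
    qed
    also have "\<dots> = (\<integral>p. F p \<omega> \<partial>(P \<Otimes>\<^sub>M Q))"
      by (rule PQ.integral_fst'[OF F_sec[OF \<omega>]])
    finally show ?thesis .
  qed
  have "(\<integral>\<omega>. (\<integral>x. \<integral>y. Z x y \<omega> \<partial>\<nu> \<partial>\<mu>) ^ card I \<partial>M) = (\<integral>\<omega>. \<integral>p. F p \<omega> \<partial>(P \<Otimes>\<^sub>M Q) \<partial>M)"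
    by (intro Bochner_Integration.integral_cong refl power)
  also have "\<dots> = (\<integral>p. \<integral>\<omega>. F p \<omega> \<partial>M \<partial>(P \<Otimes>\<^sub>M Q))"
    by (rule PQM.Fubini_integral[OF F_int])
  finally have "ennreal \<bar>\<integral>\<omega>. (\<integral>x. \<integral>y. Z x y \<omega> \<partial>\<nu> \<partial>\<mu>) ^ card I \<partial>M\<bar>
      = ennreal (norm (\<integral>p. \<integral>\<omega>. F p \<omega> \<partial>M \<partial>(P \<Otimes>\<^sub>M Q)))" by simp
  also have "\<dots> \<le> (\<integral>\<^sup>+p. ennreal (norm (\<integral>\<omega>. F p \<omega> \<partial>M)) \<partial>(P \<Otimes>\<^sub>M Q))"
    using PQM.integrable_fst'[OF F_int] by (intro integral_norm_bound_ennreal) simp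
  also have "\<dots> \<le> (\<integral>\<^sup>+p. ennreal (A (fst p)) * ennreal (B (snd p)) \<partial>(P \<Otimes>\<^sub>M Q))"
    using joint A(1) B(1) by (intro nn_integral_mono) (auto simp: F_def ennreal_mult[symmetric] intro!: ennreal_leI)
  also have "\<dots> = (\<integral>\<^sup>+x. \<integral>\<^sup>+y. ennreal (A x) * ennreal (B y) \<partial>Q \<partial>P)"
    using A(2) B(2) unfolding P_def[symmetric] Q_def[symmetric]
    by (subst Q.nn_integral_fst[symmetric]) auto
  also have "\<dots> = (\<integral>\<^sup>+x. A x \<partial>P) * (\<integral>\<^sup>+y. B y \<partial>Q)"
    using A(2) B(2) unfolding P_def[symmetric] Q_def[symmetric]
    by (simp add: nn_integral_cmult nn_integral_multc)
  finally show ?thesis unfolding P_def Q_def .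
qed

section \<open>Two-point integrals\<close>

lemma nn_integral_exp_neg_dist_le:
  fixes \<kappa> u :: real
  assumes "0 < \<kappa>"
  shows "(\<integral>\<^sup>+v. ennreal (exp (- \<kappa> * \<bar>u - v\<bar>)) \<partial>lborel) \<le> ennreal (2 / \<kappa>)"
proof -
  let ?e = "\<lambda>w::real. ennreal (exp (- \<kappa> * w)) * indicator {0..} w"
  have half: "(\<integral>\<^sup>+w. ?e w \<partial>lborel) = ennreal (0 - (- exp (- \<kappa> * 0) / \<kappa>))"
  proof (rule nn_integral_FTC_atLeast)
    show "((\<lambda>w. - exp (- \<kappa> * w) / \<kappa>) has_real_derivative exp (- \<kappa> * w)) (at w)" for w
      using assms by (auto intro!: derivative_eq_intros)
    show "((\<lambda>w. - exp (- \<kappa> * w) / \<kappa>) \<longlongrightarrow> 0) at_top"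
      using assms by real_asymp
  qed auto
  have "(\<integral>\<^sup>+v. ennreal (exp (- \<kappa> * \<bar>u - v\<bar>)) \<partial>lborel)
      = (\<integral>\<^sup>+w. ennreal (exp (- \<kappa> * \<bar>u - (u + 1 * w)\<bar>)) \<partial>lborel)"
    by (subst nn_integral_real_affine[where c = 1 and t = u]) simp_all
  also have "\<dots> \<le> (\<integral>\<^sup>+w. ?e w + ?e (0 + (- 1) * w) \<partial>lborel)"
    by (intro nn_integral_mono) (auto simp: indicator_def abs_if)
  also have "\<dots> = (\<integral>\<^sup>+w. ?e w \<partial>lborel) + (\<integral>\<^sup>+w. ?e (0 + (- 1) * w) \<partial>lborel)"
    by (rule nn_integral_add) auto
  also have "(\<integral>\<^sup>+w. ?e (0 + (- 1) * w) \<partial>lborel) = (\<integral>\<^sup>+w. ?e w \<partial>lborel)"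
    by (subst (2) nn_integral_real_affine[where c = "- 1" and t = 0]) simp_all
  also have "(\<integral>\<^sup>+w. ?e w \<partial>lborel) + (\<integral>\<^sup>+w. ?e w \<partial>lborel) = ennreal (2 / \<kappa>)"
    using assms unfolding half by (simp add: ennreal_plus[symmetric] del: ennreal_plus)
  finally show ?thesis .
qed

text \<open>By \<open>\<bar>h u\<bar> \<bar>h v\<bar> \<le> (h u)\<^sup>2 / 2 + (h v)\<^sup>2 / 2\<close> and the symmetry of the exponential it is enough to
  integrate the exponential in one of the two variables.\<close>
lemma nn_integral_exp_dist_density_le:
  fixes h :: "real \<Rightarrow> real"
  assumes [measurable]: "h \<in> borel_measurable borel" and \<kappa>: "0 < \<kappa>"
  defines "\<mu> \<equiv> density lborel (\<lambda>x. ennreal \<bar>h x\<bar>)"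
  shows "(\<integral>\<^sup>+u. \<integral>\<^sup>+v. ennreal (exp (- \<kappa> * \<bar>u - v\<bar>)) \<partial>\<mu> \<partial>\<mu>)
    \<le> ennreal (2 / \<kappa>) * (\<integral>\<^sup>+u. ennreal ((h u)\<^sup>2) \<partial>lborel)"
proof -
  let ?e = "\<lambda>u v. exp (- \<kappa> * \<bar>u - v\<bar>)"
  let ?A = "\<integral>\<^sup>+u. \<integral>\<^sup>+v. ennreal ((h u)\<^sup>2 / 2 * ?e u v) \<partial>lborel \<partial>lborel"
  have "(\<integral>\<^sup>+u. \<integral>\<^sup>+v. ennreal (?e u v) \<partial>\<mu> \<partial>\<mu>)
    = (\<integral>\<^sup>+u. \<integral>\<^sup>+v. ennreal (\<bar>h u\<bar> * \<bar>h v\<bar> * ?e u v) \<partial>lborel \<partial>lborel)"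
    unfolding \<mu>_def
    by (simp add: nn_integral_density nn_integral_cmult[symmetric] ennreal_mult[symmetric] mult.assoc)
  also have "\<dots> \<le> (\<integral>\<^sup>+u. \<integral>\<^sup>+v. ennreal ((h u)\<^sup>2 / 2 * ?e u v) + ennreal ((h v)\<^sup>2 / 2 * ?e u v) \<partial>lborel \<partial>lborel)"
  proof (intro nn_integral_mono)
    fix u v
    have "\<bar>h u\<bar> * \<bar>h v\<bar> \<le> (h u)\<^sup>2 / 2 + (h v)\<^sup>2 / 2"
      using sum_squares_bound[of "\<bar>h u\<bar>" "\<bar>h v\<bar>"] by simp
    then have "\<bar>h u\<bar> * \<bar>h v\<bar> * ?e u v \<le> ((h u)\<^sup>2 / 2 + (h v)\<^sup>2 / 2) * ?e u v"
      by (rule mult_right_mono) simp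
    then show "ennreal (\<bar>h u\<bar> * \<bar>h v\<bar> * ?e u v)
        \<le> ennreal ((h u)\<^sup>2 / 2 * ?e u v) + ennreal ((h v)\<^sup>2 / 2 * ?e u v)"
      by (simp add: ennreal_plus[symmetric] ring_distribs del: ennreal_plus)
  qed
  also have "\<dots> = ?A + (\<integral>\<^sup>+u. \<integral>\<^sup>+v. ennreal ((h v)\<^sup>2 / 2 * ?e u v) \<partial>lborel \<partial>lborel)"
    by (simp add: nn_integral_add)
  also have "(\<integral>\<^sup>+u. \<integral>\<^sup>+v. ennreal ((h v)\<^sup>2 / 2 * ?e u v) \<partial>lborel \<partial>lborel) = ?A"
    by (subst lborel_pair.Fubini') (simp_all add: abs_minus_commute)
  also have "?A + ?A = 2 * ?A" by (simp add: mult_2)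
  also have "?A = (\<integral>\<^sup>+u. ennreal ((h u)\<^sup>2 / 2) * (\<integral>\<^sup>+v. ennreal (?e u v) \<partial>lborel) \<partial>lborel)"
  proof (intro nn_integral_cong)
    fix u
    have "(\<integral>\<^sup>+v. ennreal ((h u)\<^sup>2 / 2 * ?e u v) \<partial>lborel) = (\<integral>\<^sup>+v. ennreal ((h u)\<^sup>2 / 2) * ennreal (?e u v) \<partial>lborel)"
      by (intro nn_integral_cong ennreal_mult) simp_all
    also have "\<dots> = ennreal ((h u)\<^sup>2 / 2) * (\<integral>\<^sup>+v. ennreal (?e u v) \<partial>lborel)"
      by (rule nn_integral_cmult) measurable
    finally show "(\<integral>\<^sup>+v. ennreal ((h u)\<^sup>2 / 2 * ?e u v) \<partial>lborel) = \<dots>" .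
  qed
  also have "2 * \<dots> \<le> 2 * (\<integral>\<^sup>+u. ennreal ((h u)\<^sup>2 / 2) * ennreal (2 / \<kappa>) \<partial>lborel)"
    using nn_integral_exp_neg_dist_le[OF \<kappa>] by (intro mult_left_mono nn_integral_mono) auto
  also have "\<dots> = (\<integral>\<^sup>+u. ennreal (2 / \<kappa>) * ennreal ((h u)\<^sup>2) \<partial>lborel)"
    using \<kappa> by (subst nn_integral_cmult[symmetric])
      (auto intro!: nn_integral_cong simp flip: ennreal_mult ennreal_numeral)
  also have "\<dots> = ennreal (2 / \<kappa>) * (\<integral>\<^sup>+u. ennreal ((h u)\<^sup>2) \<partial>lborel)"
    by (simp add: nn_integral_cmult)
  finally show ?thesis .
qed

lemma nn_integral_abs_finite_of_square:
  fixes h :: "real \<Rightarrow> real"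
  assumes [measurable]: "h \<in> borel_measurable borel"
    and supp: "\<And>x. h x \<noteq> 0 \<Longrightarrow> a \<le> x \<and> x \<le> b"
    and fin: "(\<integral>\<^sup>+x. ennreal ((h x)\<^sup>2) \<partial>lborel) < \<infinity>"
  shows "(\<integral>\<^sup>+x. ennreal \<bar>h x\<bar> \<partial>lborel) < \<infinity>"
proof -
  have "(\<integral>\<^sup>+x. ennreal \<bar>h x\<bar> \<partial>lborel) \<le> (\<integral>\<^sup>+x. indicator {a..b} x + ennreal ((h x)\<^sup>2) \<partial>lborel)"
  proof (intro nn_integral_mono)
    fix x
    have "\<bar>h x\<bar> \<le> 1 + (h x)\<^sup>2"
      using sum_squares_bound[of "\<bar>h x\<bar>" 1] by simp
    then have "ennreal \<bar>h x\<bar> \<le> 1 + ennreal ((h x)\<^sup>2)"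
      by (metis ennreal_1 ennreal_leI ennreal_plus zero_le_one zero_le_power2)
    then show "ennreal \<bar>h x\<bar> \<le> indicator {a..b} x + ennreal ((h x)\<^sup>2)"
      using supp[of x] by (cases "h x = 0") auto
  qed
  also have "\<dots> = emeasure lborel {a..b} + (\<integral>\<^sup>+x. ennreal ((h x)\<^sup>2) \<partial>lborel)"
    by (simp add: nn_integral_add)
  also have "\<dots> < \<infinity>"
    using fin by (simp add: ennreal_add_less_top emeasure_lborel_Icc_eq)
  finally show ?thesis .
qed

lemma finite_measure_density_of_square:
  fixes h :: "real \<Rightarrow> real"
  assumes [measurable]: "h \<in> borel_measurable borel"
    and supp: "\<And>x. h x \<noteq> 0 \<Longrightarrow> a \<le> x \<and> x \<le> b"
    and fin: "(\<integral>\<^sup>+x. ennreal ((h x)\<^sup>2) \<partial>lborel) < \<infinity>"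
  shows "finite_measure (density lborel (\<lambda>x. ennreal \<bar>h x\<bar>))"
  using nn_integral_abs_finite_of_square[OF assms]
  by (intro finite_measureI) (simp add: emeasure_density)

lemma nn_integral_pairing_weight_density_le:
  fixes h :: "real \<Rightarrow> real"
  assumes h: "h \<in> borel_measurable borel" and \<kappa>: "0 < \<kappa>"
    and V: "(\<integral>\<^sup>+x. ennreal ((h x)\<^sup>2) \<partial>lborel) \<le> ennreal V" "0 \<le> V"
    and fin: "finite_measure (density lborel (\<lambda>x. ennreal \<bar>h x\<bar>))" (is "finite_measure ?\<mu>")
    and I: "finite I" "card I = 2 * k"
  shows "(\<integral>\<^sup>+x. ennreal (pairing_weight \<kappa> k I x) \<partial>Pi\<^sub>M I (\<lambda>_. ?\<mu>)) \<le> ennreal (fact (2 * k) * (2 * V / \<kappa>) ^ k)"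
proof -
  have "(\<integral>\<^sup>+u. \<integral>\<^sup>+v. ennreal (exp (- \<kappa> * \<bar>u - v\<bar>)) \<partial>?\<mu> \<partial>?\<mu>)
      \<le> ennreal (2 / \<kappa>) * (\<integral>\<^sup>+u. ennreal ((h u)\<^sup>2) \<partial>lborel)"
    by (rule nn_integral_exp_dist_density_le[OF h \<kappa>])
  also have "\<dots> \<le> ennreal (2 / \<kappa>) * ennreal V"
    by (intro mult_left_mono V) simp
  also have "\<dots> = ennreal (2 * V / \<kappa>)"
    using \<kappa> V(2) by (simp flip: ennreal_mult)
  finally have H: "(\<integral>\<^sup>+u. \<integral>\<^sup>+v. ennreal (exp (- \<kappa> * \<bar>u - v\<bar>)) \<partial>?\<mu> \<partial>?\<mu>) \<le> ennreal (2 * V / \<kappa>)" .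
  have "(\<integral>\<^sup>+x. ennreal (pairing_weight \<kappa> k I x) \<partial>Pi\<^sub>M I (\<lambda>_. ?\<mu>))
      \<le> fact (2 * k) * (\<integral>\<^sup>+u. \<integral>\<^sup>+v. ennreal (exp (- \<kappa> * \<bar>u - v\<bar>)) \<partial>?\<mu> \<partial>?\<mu>) ^ k"
    by (rule nn_integral_pairing_weight_le[OF finite_measure.axioms(1)[OF fin] _ I]) simp
  also have "\<dots> \<le> fact (2 * k) * ennreal (2 * V / \<kappa>) ^ k"
    by (intro mult_left_mono power_mono H) auto
  also have "fact (2 * k) = ennreal (fact (2 * k))"
    by (metis ennreal_of_nat_eq_real_of_nat of_nat_fact)
  also have "ennreal (fact (2 * k)) * ennreal (2 * V / \<kappa>) ^ k = ennreal (fact (2 * k) * (2 * V / \<kappa>) ^ k)"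
    using \<kappa> V(2) by (simp add: ennreal_mult ennreal_power)
  finally show ?thesis .
qed

section \<open>Kernels and sheets as integrands\<close>

text \<open>A field is measurable over the quadrant only. Clamping the arguments at 0 extends it to the plane
  without changing it on the quadrant.\<close>
lemma measurable_field_clamped:
  assumes "measurable_field M L"
  shows "(\<lambda>((x, y), \<omega>). L (max 0 (r * x)) (max 0 (r * y)) \<omega>) \<in> borel_measurable ((borel \<Otimes>\<^sub>M borel) \<Otimes>\<^sub>M M)"
proof -
  let ?c = "\<lambda>((x, y), \<omega>). ((max 0 (r * x), max 0 (r * y)), \<omega>)"
  have "(\<lambda>(x, y). (max 0 (r * x), max 0 (r * y))) \<in> measurable (borel \<Otimes>\<^sub>M borel) (restrict_space borel ({0..} \<times> {0::real..}))"
    by (intro measurable_restrict_space2) (auto simp: borel_prod[symmetric])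
  then have "?c \<in> measurable ((borel \<Otimes>\<^sub>M borel) \<Otimes>\<^sub>M M) (restrict_space borel ({0..} \<times> {0..}) \<Otimes>\<^sub>M M)"
    by (auto simp: case_prod_unfold intro!: measurable_Pair measurable_compose[OF measurable_fst])
  from measurable_compose[OF this assms[unfolded measurable_field_def]]
  show ?thesis by (simp add: case_prod_unfold)
qed

text \<open>Condition (H1') says nothing about a kernel outside the unit square. Its increment is therefore cut
  off to the unit interval, where clamping the argument to \<open>[0, 1]\<close> shows that it is Borel. For
  \<open>s = s'\<close>, where (H1') makes no claim, the increment is 0.\<close>
lemma kernel_increment:
  assumes K: "kernel_cond K G \<rho> M \<beta>" and s: "0 \<le> s" "s \<le> s'" "s' \<le> 1"
  defines "f \<equiv> \<lambda>x. indicator {0..1} x * (K s' x - K s x)"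
  shows "f \<in> borel_measurable borel"
    and "(\<integral>\<^sup>+x. ennreal ((f x)\<^sup>2) \<partial>lborel) \<le> ennreal ((G s' - G s) powr \<rho>)"
    and "0 \<le> s0 \<Longrightarrow> s0 < s0' \<Longrightarrow> s0' \<le> 1 \<Longrightarrow>
      (\<integral>\<^sup>+x. ennreal ((indicator {s0<..s0'} x * f x)\<^sup>2) \<partial>lborel) \<le> ennreal (M * (s0' - s0) powr \<beta>)"
proof -
  have sec: "(\<lambda>x. K u (max 0 (min 1 x))) \<in> borel_measurable borel" if "0 \<le> u" "u \<le> 1" for u
  proof -
    have "(\<lambda>x. (u, max 0 (min 1 x))) \<in> measurable borel (restrict_space borel ({0..1} \<times> {0..1::real}))"
      using that by (intro measurable_restrict_space2) (auto simp: borel_prod[symmetric])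
    from measurable_compose[OF this, of "\<lambda>(s, r). K s r" borel] K show ?thesis
      by (simp add: kernel_cond_def)
  qed
  have [measurable]: "(\<lambda>x. K s (max 0 (min 1 x))) \<in> borel_measurable borel"
    "(\<lambda>x. K s' (max 0 (min 1 x))) \<in> borel_measurable borel"
    using s by (auto intro!: sec)
  have "f = (\<lambda>x. indicator {0..1} x * (K s' (max 0 (min 1 x)) - K s (max 0 (min 1 x))))"
    by (auto simp: f_def indicator_def max_def min_def)
  also have "\<dots> \<in> borel_measurable borel" by measurable
  finally show "f \<in> borel_measurable borel" .
  have sq: "ennreal ((f x)\<^sup>2) = ennreal ((K s' x - K s x)\<^sup>2) * indicator {0..1} x" for x
    by (simp add: f_def indicator_def)
  have zero: "f x = 0" if "s = s'" for x using that by (simp add: f_def)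
  show "(\<integral>\<^sup>+x. ennreal ((f x)\<^sup>2) \<partial>lborel) \<le> ennreal ((G s' - G s) powr \<rho>)"
  proof (cases "s = s'")
    case False
    then show ?thesis using K s unfolding sq by (auto simp: kernel_cond_def)
  qed (simp add: zero)
  assume s0: "0 \<le> s0" "s0 < s0'" "s0' \<le> 1"
  show "(\<integral>\<^sup>+x. ennreal ((indicator {s0<..s0'} x * f x)\<^sup>2) \<partial>lborel) \<le> ennreal (M * (s0' - s0) powr \<beta>)"
  proof (cases "s = s'")
    case False
    have "(\<integral>\<^sup>+x. ennreal ((indicator {s0<..s0'} x * f x)\<^sup>2) \<partial>lborel)
        \<le> (\<integral>\<^sup>+x\<in>{s0..s0'}. ennreal ((K s' x - K s x)\<^sup>2) \<partial>lborel)"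
      using s0 by (intro nn_integral_mono) (auto simp: f_def indicator_def)
    also have "\<dots> \<le> ennreal (M * (s0' - s0) powr \<beta>)"
      using K s s0 False by (simp add: kernel_cond_def)
    finally show ?thesis .
  qed (simp add: zero)
qed

text \<open>The functions \<open>f x \<surd>x\<close> and \<open>g y \<surd>y\<close> become densities of finite measures, their signs join the bounded
  random factor. The two-point integrals are at most \<open>4SF / (r\<^sup>2\<alpha>T)\<close> and \<open>4TG / (r\<^sup>2\<alpha>S)\<close>: since
  the supports lie in \<open>[S, 2S]\<close> and \<open>[T, 2T]\<close>, the position of the rectangle cancels in the product,
  and the power \<open>r ^ (- 4k)\<close> remains.\<close>
lemma sheet_integral_moment_le:
  fixes L :: "real \<Rightarrow> real \<Rightarrow> 'a \<Rightarrow> real" and f g :: "real \<Rightarrow> real"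
  assumes L: "levy_sheet M L (\<lambda>\<xi>. complex_of_real (a \<xi>) + \<i> * complex_of_real (b \<xi>))"
    and field: "measurable_field M L" and r: "0 < r" and ST: "0 < S" "0 < T"
    and \<alpha>: "0 < \<alpha>" "\<And>j. j \<in> {1..2 * k} \<Longrightarrow> \<alpha> \<le> a (real j * \<theta>)"
    and trig: "trig \<in> {cos, sin}"
    and [measurable]: "f \<in> borel_measurable borel" "g \<in> borel_measurable borel"
    and f: "\<And>x. f x \<noteq> 0 \<Longrightarrow> S \<le> x \<and> x \<le> 2 * S" "(\<integral>\<^sup>+x. ennreal ((f x)\<^sup>2) \<partial>lborel) \<le> ennreal F" "0 \<le> F"
    and g: "\<And>y. g y \<noteq> 0 \<Longrightarrow> T \<le> y \<and> y \<le> 2 * T" "(\<integral>\<^sup>+y. ennreal ((g y)\<^sup>2) \<partial>lborel) \<le> ennreal G" "0 \<le> G"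
  shows "(\<integral>\<omega>. (\<integral>x. \<integral>y. (f x * sqrt x) * (g y * sqrt y) * trig (\<theta> * L (r * x) (r * y) \<omega>) \<partial>lborel \<partial>lborel) ^ (2 * k) \<partial>M)
    \<le> (fact (2 * k))\<^sup>2 * (16 * F * G / (r ^ 4 * \<alpha>\<^sup>2)) ^ k"
proof -
  define h1 where "h1 x = f x * sqrt x" for x
  define h2 where "h2 y = g y * sqrt y" for y
  have [measurable]: "h1 \<in> borel_measurable borel" "h2 \<in> borel_measurable borel"
    unfolding h1_def h2_def by measurable
  have supp1: "S \<le> x \<and> x \<le> 2 * S" if "h1 x \<noteq> 0" for x using that f(1) by (auto simp: h1_def)
  have supp2: "T \<le> y \<and> y \<le> 2 * T" if "h2 y \<noteq> 0" for y using that g(1) by (auto simp: h2_def)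
  have sq_le: "(\<integral>\<^sup>+x. ennreal ((u x * sqrt x)\<^sup>2) \<partial>lborel) \<le> ennreal (2 * R) * ennreal U"
    if [measurable]: "u \<in> borel_measurable borel" and u: "\<And>x. u x \<noteq> 0 \<Longrightarrow> R \<le> x \<and> x \<le> 2 * R"
      "(\<integral>\<^sup>+x. ennreal ((u x)\<^sup>2) \<partial>lborel) \<le> ennreal U" "0 < R" for u R U
  proof -
    have "(\<integral>\<^sup>+x. ennreal ((u x * sqrt x)\<^sup>2) \<partial>lborel) \<le> (\<integral>\<^sup>+x. ennreal (2 * R) * ennreal ((u x)\<^sup>2) \<partial>lborel)"
    proof (intro nn_integral_mono)
      fix x
      have "(u x * sqrt x)\<^sup>2 \<le> 2 * R * (u x)\<^sup>2"
      proof (cases "u x = 0")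
        case False
        then have "(u x * sqrt x)\<^sup>2 = x * (u x)\<^sup>2" using u(1)[of x] \<open>0 < R\<close> by (simp add: power_mult_distrib)
        then show ?thesis using u(1)[OF False] by (simp add: mult_right_mono)
      qed simp
      then show "ennreal ((u x * sqrt x)\<^sup>2) \<le> ennreal (2 * R) * ennreal ((u x)\<^sup>2)"
        using \<open>0 < R\<close> by (simp add: ennreal_mult[symmetric] ennreal_leI)
    qed
    also have "\<dots> = ennreal (2 * R) * (\<integral>\<^sup>+x. ennreal ((u x)\<^sup>2) \<partial>lborel)"
      by (simp add: nn_integral_cmult)
    also have "\<dots> \<le> ennreal (2 * R) * ennreal U" by (intro mult_left_mono u) simp
    finally show ?thesis .
  qed
  have sq1: "(\<integral>\<^sup>+x. ennreal ((h1 x)\<^sup>2) \<partial>lborel) \<le> ennreal (2 * S) * ennreal F"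
    unfolding h1_def by (rule sq_le) (use f ST in auto)
  have sq2: "(\<integral>\<^sup>+y. ennreal ((h2 y)\<^sup>2) \<partial>lborel) \<le> ennreal (2 * T) * ennreal G"
    unfolding h2_def by (rule sq_le) (use g ST in auto)
  define \<mu> where "\<mu> = density lborel (\<lambda>x. ennreal \<bar>h1 x\<bar>)"
  define \<nu> where "\<nu> = density lborel (\<lambda>y. ennreal \<bar>h2 y\<bar>)"
  have sets [measurable_cong, simp]: "sets \<mu> = sets borel" "sets \<nu> = sets borel"
    by (simp_all add: \<mu>_def \<nu>_def)
  have fin: "finite_measure \<mu>" "finite_measure \<nu>"
    unfolding \<mu>_def \<nu>_def
    by (rule finite_measure_density_of_square[OF _ supp1] finite_measure_density_of_square[OF _ supp2],
        use sq1 sq2 in \<open>auto intro: le_less_trans simp: ennreal_mult[symmetric] ennreal_mult_less_top\<close>)+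
  define I where "I = {..<2 * k}"
  have I: "finite I" "card I = 2 * k" by (auto simp: I_def)
  define Z where "Z x y \<omega> = indicator {S..} x * indicator {T..} y * sgn (h1 x) * sgn (h2 y)
      * trig (\<theta> * L (max 0 (r * x)) (max 0 (r * y)) \<omega>)" for x y \<omega>
  have trig_le: "\<bar>trig z\<bar> \<le> 1" for z using trig by auto
  have [measurable]: "trig \<in> borel_measurable borel" using trig by auto
  note field_meas = measurable_field_clamped[OF field, of r, measurable]
  have Z_meas: "(\<lambda>((x, y), \<omega>). Z x y \<omega>) \<in> borel_measurable ((\<mu> \<Otimes>\<^sub>M \<nu>) \<Otimes>\<^sub>M M)"
    using field_meas unfolding Z_def case_prod_unfold by measurable
  have Z_le: "\<bar>Z x y \<omega>\<bar> \<le> 1" for x y \<omega>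
  proof -
    have "\<bar>Z x y \<omega>\<bar> = \<bar>indicator {S..} x * indicator {T..} y * sgn (h1 x) * sgn (h2 y)\<bar>
      * \<bar>trig (\<theta> * L (max 0 (r * x)) (max 0 (r * y)) \<omega>)\<bar>" by (simp add: Z_def abs_mult)
    also have "\<dots> \<le> 1 * 1"
      by (intro mult_mono trig_le) (auto simp: indicator_def sgn_if)
    finally show ?thesis by simp
  qed
  define A where "A = pairing_weight (r\<^sup>2 * \<alpha> * T) k I"
  define B where "B = pairing_weight (r\<^sup>2 * \<alpha> * S) k I"
  \<comment> \<open>Outside the supports \<open>Z\<close> vanishes, so that the bound is only needed for points with
    \<open>x i \<ge> S\<close> and \<open>y i \<ge> T\<close>.\<close>
  have joint: "\<bar>\<integral>\<omega>. (\<Prod>i\<in>I. Z (x i) (y i) \<omega>) \<partial>M\<bar> \<le> A x * B y" for x y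
  proof (cases "\<forall>i\<in>I. S \<le> x i \<and> T \<le> y i")
    case True
    define c where "c = (\<Prod>i\<in>I. sgn (h1 (x i)) * sgn (h2 (y i)))"
    have c: "\<bar>c\<bar> \<le> 1"
      unfolding c_def abs_prod by (intro prod_le_1) (auto simp: abs_mult sgn_if)
    have max: "max 0 (r * x i) = r * x i" "max 0 (r * y i) = r * y i" if "i \<in> I" for i
      using True that r ST by (auto intro!: max_absorb2 mult_nonneg_nonneg intro: order_trans[OF less_imp_le])
    have "(\<Prod>i\<in>I. Z (x i) (y i) \<omega>) = c * (\<Prod>i\<in>I. trig (\<theta> * L (r * x i) (r * y i) \<omega>))" for \<omega>
      unfolding c_def prod.distrib[symmetric] using True max by (intro prod.cong) (auto simp: Z_def)
    then have "\<bar>\<integral>\<omega>. (\<Prod>i\<in>I. Z (x i) (y i) \<omega>) \<partial>M\<bar>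
      = \<bar>c\<bar> * \<bar>\<integral>\<omega>. (\<Prod>i\<in>I. trig (\<theta> * L (r * x i) (r * y i) \<omega>)) \<partial>M\<bar>"
      by (simp add: abs_mult)
    also have "\<dots> \<le> 1 * (A x * B y)"
      unfolding A_def B_def using c True \<alpha> I ST
      by (intro mult_mono levy_sheet_trig_moment_le[OF L r]) (use trig in auto)
    finally show ?thesis by simp
  next
    case False
    then obtain i where "i \<in> I" "\<not> (S \<le> x i \<and> T \<le> y i)" by auto
    then have "(\<Prod>i\<in>I. Z (x i) (y i) \<omega>) = 0" for \<omega>
      using I(1) by (intro prod_zero bexI[of _ i]) (auto simp: Z_def)
    then show ?thesis by (simp add: A_def B_def pairing_weight_nonneg)
  qed
  have H1: "(\<integral>\<^sup>+x. ennreal (A x) \<partial>Pi\<^sub>M I (\<lambda>_. \<mu>)) \<le> ennreal (fact (2 * k) * (2 * (2 * S * F) / (r\<^sup>2 * \<alpha> * T)) ^ k)"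
  proof -
    have "(\<integral>\<^sup>+x. ennreal ((h1 x)\<^sup>2) \<partial>lborel) \<le> ennreal (2 * S * F)"
      using sq1 ST f(3) by (simp add: ennreal_mult)
    then show ?thesis
      unfolding A_def \<mu>_def
      using r \<alpha>(1) ST f(3) fin(1) I
      by (intro nn_integral_pairing_weight_density_le) (auto simp: \<mu>_def)
  qed
  have H2: "(\<integral>\<^sup>+y. ennreal (B y) \<partial>Pi\<^sub>M I (\<lambda>_. \<nu>)) \<le> ennreal (fact (2 * k) * (2 * (2 * T * G) / (r\<^sup>2 * \<alpha> * S)) ^ k)"
  proof -
    have "(\<integral>\<^sup>+y. ennreal ((h2 y)\<^sup>2) \<partial>lborel) \<le> ennreal (2 * T * G)"
      using sq2 ST g(3) by (simp add: ennreal_mult)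
    then show ?thesis
      unfolding B_def \<nu>_def
      using r \<alpha>(1) ST g(3) fin(2) I
      by (intro nn_integral_pairing_weight_density_le) (auto simp: \<nu>_def)
  qed
  have prob: "prob_space M" using L by (rule levy_sheet_prob_space)
  have "ennreal \<bar>\<integral>\<omega>. (\<integral>x. \<integral>y. Z x y \<omega> \<partial>\<nu> \<partial>\<mu>) ^ card I \<partial>M\<bar>
      \<le> (\<integral>\<^sup>+x. A x \<partial>Pi\<^sub>M I (\<lambda>_. \<mu>)) * (\<integral>\<^sup>+y. B y \<partial>Pi\<^sub>M I (\<lambda>_. \<nu>))"
    by (rule moment_of_double_integral_le[OF prob fin Z_meas Z_le I(1) joint])
      (auto simp: A_def B_def pairing_weight_nonneg intro!: pairing_weight_measurable)
  also have "\<dots> \<le> ennreal (fact (2 * k) * (2 * (2 * S * F) / (r\<^sup>2 * \<alpha> * T)) ^ k)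
      * ennreal (fact (2 * k) * (2 * (2 * T * G) / (r\<^sup>2 * \<alpha> * S)) ^ k)"
    by (intro mult_mono H1 H2) auto
  also have "\<dots> = ennreal ((fact (2 * k) * (2 * (2 * S * F) / (r\<^sup>2 * \<alpha> * T)) ^ k)
      * (fact (2 * k) * (2 * (2 * T * G) / (r\<^sup>2 * \<alpha> * S)) ^ k))"
    using r \<alpha>(1) ST f(3) g(3) by (intro ennreal_mult[symmetric]) auto
  also have "\<dots> = ennreal ((fact (2 * k))\<^sup>2 * (16 * F * G / (r ^ 4 * \<alpha>\<^sup>2)) ^ k)"
  proof -
    have "(2 * (2 * S * F) / (r\<^sup>2 * \<alpha> * T)) * (2 * (2 * T * G) / (r\<^sup>2 * \<alpha> * S))
        = (16 * F * G) * (S * T) / ((r ^ 4 * \<alpha>\<^sup>2) * (S * T))"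
      by (simp add: power2_eq_square power4_eq_xxxx)
    also have "\<dots> = 16 * F * G / (r ^ 4 * \<alpha>\<^sup>2)"
      using ST by (intro mult_divide_mult_cancel_right) simp
    finally have ratio: "(2 * (2 * S * F) / (r\<^sup>2 * \<alpha> * T)) * (2 * (2 * T * G) / (r\<^sup>2 * \<alpha> * S))
        = 16 * F * G / (r ^ 4 * \<alpha>\<^sup>2)" .
    have "(c * X ^ k) * (c * Y ^ k) = c\<^sup>2 * (X * Y) ^ k" for c X Y :: real
      by (simp add: power_mult_distrib power2_eq_square)
    from this[of "fact (2 * k)"] show ?thesis by (simp only: ratio)
  qed
  finally have bound: "\<bar>\<integral>\<omega>. (\<integral>x. \<integral>y. Z x y \<omega> \<partial>\<nu> \<partial>\<mu>) ^ card I \<partial>M\<bar>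
      \<le> (fact (2 * k))\<^sup>2 * (16 * F * G / (r ^ 4 * \<alpha>\<^sup>2)) ^ k"
    using \<alpha>(1) r f(3) g(3) by (simp add: ennreal_le_iff)
  have unfold: "(\<integral>x. \<integral>y. Z x y \<omega> \<partial>\<nu> \<partial>\<mu>)
      = (\<integral>x. \<integral>y. (f x * sqrt x) * (g y * sqrt y) * trig (\<theta> * L (r * x) (r * y) \<omega>) \<partial>lborel \<partial>lborel)"
    if \<omega>: "\<omega> \<in> space M" for \<omega>
  proof -
    have Z_pair: "(\<lambda>(x, y). Z x y \<omega>) \<in> borel_measurable (borel \<Otimes>\<^sub>M \<nu>)"
      using measurable_compose[OF _ Z_meas, of "\<lambda>p. (p, \<omega>)" "\<mu> \<Otimes>\<^sub>M \<nu>"] \<omega>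
      by (simp add: case_prod_unfold cong: measurable_cong_sets[OF sets_pair_measure_cong])
    have Z_sec [measurable]: "(\<lambda>y. Z x y \<omega>) \<in> borel_measurable borel" for x
      using measurable_compose[OF measurable_Pair1' Z_pair, of x] by simp
    interpret \<nu>: finite_measure \<nu> by (rule fin(2))
    have outer [measurable]: "(\<lambda>x. \<integral>y. Z x y \<omega> \<partial>\<nu>) \<in> borel_measurable borel"
      using Z_pair by (rule \<nu>.borel_measurable_lebesgue_integral)
    have point: "\<bar>h1 x\<bar> * (\<bar>h2 y\<bar> * Z x y \<omega>)
        = (f x * sqrt x) * (g y * sqrt y) * trig (\<theta> * L (r * x) (r * y) \<omega>)" for x y
    proof (cases "h1 x = 0 \<or> h2 y = 0")
      case True
      then show ?thesis by (auto simp: h1_def h2_def)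
    next
      case False
      then have xy: "S \<le> x" "T \<le> y" using supp1 supp2 by blast+
      then have "max 0 (r * x) = r * x" "max 0 (r * y) = r * y"
        using ST r by (simp_all add: max_absorb2)
      then have "\<bar>h1 x\<bar> * (\<bar>h2 y\<bar> * Z x y \<omega>)
          = (\<bar>h1 x\<bar> * sgn (h1 x)) * (\<bar>h2 y\<bar> * sgn (h2 y)) * trig (\<theta> * L (r * x) (r * y) \<omega>)"
        using xy by (simp add: Z_def)
      then show ?thesis by (simp only: abs_mult_sgn h1_def h2_def)
    qed
    have "(\<integral>x. \<integral>y. Z x y \<omega> \<partial>\<nu> \<partial>\<mu>) = (\<integral>x. \<bar>h1 x\<bar> * (\<integral>y. Z x y \<omega> \<partial>\<nu>) \<partial>lborel)"
      unfolding \<mu>_def by (subst integral_density) auto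
    also have "\<dots> = (\<integral>x. \<integral>y. \<bar>h1 x\<bar> * (\<bar>h2 y\<bar> * Z x y \<omega>) \<partial>lborel \<partial>lborel)"
      unfolding \<nu>_def by (subst integral_density) auto
    finally show ?thesis by (simp only: point)
  qed
  have "(\<integral>\<omega>. (\<integral>x. \<integral>y. (f x * sqrt x) * (g y * sqrt y) * trig (\<theta> * L (r * x) (r * y) \<omega>) \<partial>lborel \<partial>lborel) ^ (2 * k) \<partial>M)
    = (\<integral>\<omega>. (\<integral>x. \<integral>y. Z x y \<omega> \<partial>\<nu> \<partial>\<mu>) ^ card I \<partial>M)"
    using unfold I(2) by (intro Bochner_Integration.integral_cong) simp_all
  then show ?thesis using bound by linarith
qed

section \<open>Rectangular increments of the process\<close>

lemma rect_incr_set_integral: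
  fixes \<Phi> :: "real \<times> real \<Rightarrow> real"
  assumes int: "set_integrable lborel ({0..1} \<times> {0..1}) \<Phi>"
    and s: "0 \<le> s" "s \<le> s'" "s' \<le> 1" and t: "0 \<le> t" "t \<le> t'" "t' \<le> 1"
  shows "rect_incr (\<lambda>u v. LINT p:{0..u} \<times> {0..v}|lborel. \<Phi> p) s t s' t'
    = (\<integral>x. \<integral>y. indicator {s<..s'} x * indicator {t<..t'} y * \<Phi> (x, y) \<partial>lborel \<partial>lborel)"
proof -
  have sub: "integrable lborel (\<lambda>p. indicator ({0..u} \<times> {0..v}) p * \<Phi> p)" if "u \<le> 1" "v \<le> 1" for u v :: real
  proof -
    have "{0..u} \<times> {0..v} \<in> sets (lborel :: (real \<times> real) measure)"
      by (simp add: borel_prod[symmetric])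
    then have "set_integrable lborel ({0..u} \<times> {0..v}) \<Phi>"
      by (rule set_integrable_subset[OF int]) (use that in auto)
    then show ?thesis by (simp add: set_integrable_def)
  qed
  have ind: "indicator ({0..s'} \<times> {0..t'}) p * \<Phi> p - indicator ({0..s'} \<times> {0..t}) p * \<Phi> p
      - indicator ({0..s} \<times> {0..t'}) p * \<Phi> p + indicator ({0..s} \<times> {0..t}) p * \<Phi> p
      = indicator {s<..s'} (fst p) * indicator {t<..t'} (snd p) * \<Phi> p" for p
    using s t by (cases p) (auto simp: indicator_def)
  note ints = sub[of s' t'] sub[of s' t] sub[of s t'] sub[of s t]
  have int': "integrable (lborel \<Otimes>\<^sub>M lborel) (\<lambda>p. indicator {s<..s'} (fst p) * indicator {t<..t'} (snd p) * \<Phi> p)"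
    unfolding lborel_prod ind[symmetric] using ints s t by simp
  have "rect_incr (\<lambda>u v. LINT p:{0..u} \<times> {0..v}|lborel. \<Phi> p) s t s' t'
    = (\<integral>p. indicator ({0..s'} \<times> {0..t'}) p * \<Phi> p - indicator ({0..s'} \<times> {0..t}) p * \<Phi> p
      - indicator ({0..s} \<times> {0..t'}) p * \<Phi> p + indicator ({0..s} \<times> {0..t}) p * \<Phi> p \<partial>lborel)"
    using ints s t by (simp add: rect_incr_def set_lebesgue_integral_def)
  also have "\<dots> = (\<integral>p. indicator {s<..s'} (fst p) * indicator {t<..t'} (snd p) * \<Phi> p \<partial>(lborel \<Otimes>\<^sub>M lborel))"
    unfolding ind lborel_prod ..
  also have "\<dots> = (\<integral>x. \<integral>y. indicator {s<..s'} x * indicator {t<..t'} y * \<Phi> (x, y) \<partial>lborel \<partial>lborel)"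
    using lborel_pair.integral_fst'[OF int'] by simp
  finally show ?thesis .
qed

lemma integrable_tensor:
  fixes f g :: "real \<Rightarrow> real"
  assumes [measurable]: "f \<in> borel_measurable borel" "g \<in> borel_measurable borel"
    and fin: "(\<integral>\<^sup>+x. ennreal \<bar>f x\<bar> \<partial>lborel) < \<infinity>" "(\<integral>\<^sup>+y. ennreal \<bar>g y\<bar> \<partial>lborel) < \<infinity>"
  shows "integrable (lborel :: (real \<times> real) measure) (\<lambda>p. f (fst p) * g (snd p))"
  unfolding lborel_prod[symmetric]
proof (rule integrableI_bounded)
  have "(\<integral>\<^sup>+p. ennreal (norm (f (fst p) * g (snd p))) \<partial>(lborel \<Otimes>\<^sub>M lborel))
    = (\<integral>\<^sup>+x. \<integral>\<^sup>+y. ennreal \<bar>f x\<bar> * ennreal \<bar>g y\<bar> \<partial>lborel \<partial>lborel)"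
    by (subst lborel.nn_integral_fst[symmetric]) (simp_all add: abs_mult ennreal_mult)
  also have "\<dots> = (\<integral>\<^sup>+x. ennreal \<bar>f x\<bar> \<partial>lborel) * (\<integral>\<^sup>+y. ennreal \<bar>g y\<bar> \<partial>lborel)"
    by (simp add: nn_integral_cmult nn_integral_multc)
  also have "\<dots> < \<infinity>" using fin by (simp add: ennreal_mult_less_top)
  finally show "(\<integral>\<^sup>+p. ennreal (norm (f (fst p) * g (snd p))) \<partial>(lborel \<Otimes>\<^sub>M lborel)) < \<infinity>" .
qed measurable

text \<open>The rectangular increment of an indefinite integral is the integral over the rectangle.
  Integrability is needed for this; it holds because square integrable functions on the unit
  interval are integrable and the random kernel is bounded there.\<close>
lemma rect_incr_Y_process:
  assumes field: "measurable_field M L" and \<omega>: "\<omega> \<in> space M" and trig: "trig \<in> {cos, sin}"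
    and K1: "kernel_cond K1 G1 \<rho>1 M1 \<beta>1" and K2: "kernel_cond K2 G2 \<rho>2 M2 \<beta>2"
    and s: "0 \<le> s" "s \<le> s'" "s' \<le> 1" and t: "0 \<le> t" "t \<le> t'" "t' \<le> 1"
    and s0: "0 \<le> s0" "s0 \<le> s0'" "s0' \<le> 1" and t0: "0 \<le> t0" "t0 \<le> t0'" "t0' \<le> 1"
  defines "f \<equiv> \<lambda>x. indicator {s0<..s0'} x * (indicator {0..1} x * (K1 s' x - K1 s x))"
    and "g \<equiv> \<lambda>y. indicator {t0<..t0'} y * (indicator {0..1} y * (K2 t' y - K2 t y))"
  shows "rect_incr (Y_process K1 K2 s t s' t' (sheet_kernel trig c \<theta> L n) \<omega>) s0 t0 s0' t0'
    = real n * c * (\<integral>x. \<integral>y. (f x * sqrt x) * (g y * sqrt y)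
        * trig (\<theta> * L (sqrt (real n) * x) (sqrt (real n) * y) \<omega>) \<partial>lborel \<partial>lborel)"
proof -
  define \<Phi> where "\<Phi> p = (K1 s' (fst p) - K1 s (fst p)) * (K2 t' (snd p) - K2 t (snd p))
      * sheet_kernel trig c \<theta> L n (fst p) (snd p) \<omega>" for p
  define f1 where "f1 x = indicator {0..1} x * (K1 s' x - K1 s x)" for x :: real
  define g1 where "g1 y = indicator {0..1} y * (K2 t' y - K2 t y)" for y :: real
  note f1 = kernel_increment[OF K1 s, folded f1_def]
  note g1 = kernel_increment[OF K2 t, folded g1_def]
  note [measurable] = f1(1) g1(1)
  define N where "N p = real n * c * sqrt (fst p * snd p) * trig (\<theta> *
      L (max 0 (sqrt (real n) * fst p)) (max 0 (sqrt (real n) * snd p)) \<omega>)" for p :: "real \<times> real"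
  have [measurable]: "trig \<in> borel_measurable borel" using trig by auto
  have [measurable]: "(\<lambda>p. L (max 0 (sqrt (real n) * fst p)) (max 0 (sqrt (real n) * snd p)) \<omega>) \<in> borel_measurable (borel \<Otimes>\<^sub>M borel)"
    using measurable_compose[OF _ measurable_field_clamped[OF field, of "sqrt (real n)"],
        of "\<lambda>p. (p, \<omega>)" "borel \<Otimes>\<^sub>M borel"] \<omega> by (simp add: case_prod_unfold)
  have "N \<in> borel_measurable (borel \<Otimes>\<^sub>M borel)"
    unfolding N_def by measurable
  then have [measurable]: "N \<in> borel_measurable borel"
    by (simp add: borel_prod)
  have \<Phi>_eq: "indicator ({0..1} \<times> {0..1}) p * \<Phi> p
      = indicator ({0..1} \<times> {0..1}) p * (f1 (fst p) * g1 (snd p) * N p)" for p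
    by (cases p) (auto simp: indicator_def \<Phi>_def f1_def g1_def N_def sheet_kernel_def)
  have finite: "(\<integral>\<^sup>+x. ennreal \<bar>f1 x\<bar> \<partial>lborel) < \<infinity>" "(\<integral>\<^sup>+y. ennreal \<bar>g1 y\<bar> \<partial>lborel) < \<infinity>"
    by (rule nn_integral_abs_finite_of_square[OF f1(1) _ le_less_trans[OF f1(2)], of 0 1]
        nn_integral_abs_finite_of_square[OF g1(1) _ le_less_trans[OF g1(2)], of 0 1];
      auto simp: f1_def g1_def indicator_def split: if_splits)+
  have "integrable lborel (\<lambda>p. (real n * \<bar>c\<bar>) * (f1 (fst p) * g1 (snd p)))"
    by (intro integrable_mult_right integrable_tensor f1(1) g1(1) finite)
  then have "integrable lborel (\<lambda>p. indicator ({0..1} \<times> {0..1}) p * \<Phi> p)"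
    unfolding \<Phi>_eq
  proof (rule Bochner_Integration.integrable_bound)
    have [measurable]: "{0..1} \<times> {0..1::real} \<in> sets (borel :: (real \<times> real) measure)"
      by (simp add: borel_prod[symmetric])
    have [measurable]: "(\<lambda>p::real \<times> real. f1 (fst p)) \<in> borel_measurable borel"
       "(\<lambda>p::real \<times> real. g1 (snd p)) \<in> borel_measurable borel"
      unfolding borel_prod[symmetric] by measurable
    show "(\<lambda>p. indicator ({0..1} \<times> {0..1}) p * (f1 (fst p) * g1 (snd p) * N p)) \<in> borel_measurable lborel"
      by measurable
    have "\<bar>N p\<bar> \<le> real n * \<bar>c\<bar>" if "p \<in> {0..1} \<times> {0..1}" for p
    proof -
      have "sqrt (fst p * snd p) \<le> 1" using that by (cases p) (auto intro: mult_le_one)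
      moreover have "\<bar>trig z\<bar> \<le> 1" for z using trig by auto
      ultimately have "real n * \<bar>c\<bar> * (\<bar>sqrt (fst p * snd p)\<bar> * \<bar>trig (\<theta> *
        L (max 0 (sqrt (real n) * fst p)) (max 0 (sqrt (real n) * snd p)) \<omega>)\<bar>) \<le> real n * \<bar>c\<bar> * (1 * 1)"
        using that by (intro mult_left_mono mult_mono) (cases p, auto)+
      then show ?thesis by (simp add: N_def abs_mult mult.assoc)
    qed
    then have "norm (indicator ({0..1} \<times> {0..1}) p * (f1 (fst p) * g1 (snd p) * N p))
        \<le> norm (real n * \<bar>c\<bar> * (f1 (fst p) * g1 (snd p)))" for p
    proof (cases "p \<in> {0..1} \<times> {0..1}")
      case True
      then have "\<bar>f1 (fst p) * g1 (snd p)\<bar> * \<bar>N p\<bar> \<le> \<bar>f1 (fst p) * g1 (snd p)\<bar> * (real n * \<bar>c\<bar>)"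
        using \<open>\<And>p. p \<in> _ \<Longrightarrow> \<bar>N p\<bar> \<le> _\<close> by (intro mult_left_mono) auto
      then show ?thesis using True by (simp add: abs_mult mult_ac)
    qed simp
    then show "AE p in lborel. norm (indicator ({0..1} \<times> {0..1}) p * (f1 (fst p) * g1 (snd p) * N p))
        \<le> norm (real n * \<bar>c\<bar> * (f1 (fst p) * g1 (snd p)))" by simp
  qed
  then have int: "set_integrable lborel ({0..1} \<times> {0..1}) \<Phi>"
    by (simp add: set_integrable_def)
  have "rect_incr (Y_process K1 K2 s t s' t' (sheet_kernel trig c \<theta> L n) \<omega>) s0 t0 s0' t0'
    = rect_incr (\<lambda>u v. LINT p:{0..u} \<times> {0..v}|lborel. \<Phi> p) s0 t0 s0' t0'"
    by (simp only: rect_incr_def Y_process_def \<Phi>_def)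
  also have "\<dots> = (\<integral>x. \<integral>y. indicator {s0<..s0'} x * indicator {t0<..t0'} y * \<Phi> (x, y) \<partial>lborel \<partial>lborel)"
    by (rule rect_incr_set_integral[OF int s0 t0])
  also have "\<dots> = (\<integral>x. \<integral>y. (real n * c) * ((f x * sqrt x) * (g y * sqrt y)
        * trig (\<theta> * L (sqrt (real n) * x) (sqrt (real n) * y) \<omega>)) \<partial>lborel \<partial>lborel)"
    using s0 t0 by (intro Bochner_Integration.integral_cong refl)
      (auto simp: \<Phi>_def f_def g_def sheet_kernel_def indicator_def real_sqrt_mult)
  finally show ?thesis by simp
qed

section \<open>The moment bound\<close>

text \<open>The powers of \<open>r\<close> cancel: the kernels contribute \<open>r ^ (2m)\<close> and the moment of the integral
  \<open>r ^ (- 4k)\<close>, where \<open>m = 2k\<close>. A bound \<open>\<surd>(A^\<rho> M \<delta>^\<beta>)\<close> to the power \<open>k\<close> has the exponents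
  \<open>m\<rho>/4\<close>, \<open>m/4\<close> and \<open>m\<beta>/4\<close>, and \<open>\<delta> \<le> 1\<close> allows to lower the last one to \<open>m\<gamma>\<close>.\<close>
lemma kernel_moment_constant:
  fixes \<gamma> :: real
  assumes A: "0 \<le> A1" "0 \<le> A2" and M: "0 < M1" "0 < M2"
    and \<delta>: "0 < \<delta>1" "\<delta>1 \<le> 1" "0 < \<delta>2" "\<delta>2 \<le> 1"
    and \<gamma>: "\<gamma> \<le> \<beta>1 / 4" "\<gamma> \<le> \<beta>2 / 4" and k: "0 < k" and \<alpha>: "0 < \<alpha>" and r: "0 < r"
  defines "m \<equiv> 2 * k"
  shows "(r\<^sup>2 * c) ^ m * ((fact m)\<^sup>2
      * (16 * sqrt (A1 powr \<rho>1 * (M1 * \<delta>1 powr \<beta>1)) * sqrt (A2 powr \<rho>2 * (M2 * \<delta>2 powr \<beta>2)) / (r ^ 4 * \<alpha>\<^sup>2)) ^ k)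
    \<le> ((4 * c / \<alpha>) ^ m * (fact m)\<^sup>2 * (M1 * M2) powr (real m / 4))
      * A1 powr (real m * \<rho>1 / 4) * A2 powr (real m * \<rho>2 / 4) * (\<delta>1 * \<delta>2) powr (real m * \<gamma>)"
proof -
  have half: "sqrt (A powr \<rho> * (N * \<delta> powr \<beta>)) ^ k
      \<le> N powr (real m / 4) * A powr (real m * \<rho> / 4) * \<delta> powr (real m * \<gamma>)"
    if "0 \<le> A" "0 < N" "0 < \<delta>" "\<delta> \<le> 1" "\<gamma> \<le> \<beta> / 4" for A \<rho> N \<delta> \<beta>
  proof -
    have "sqrt (A powr \<rho> * (N * \<delta> powr \<beta>)) ^ k = ((A powr \<rho> * (N * \<delta> powr \<beta>)) powr (1 / 2)) powr real k"
      using that k by (simp add: powr_half_sqrt powr_realpow')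
    also have "\<dots> = N powr (real m / 4) * A powr (real m * \<rho> / 4) * \<delta> powr (real m * (\<beta> / 4))"
      by (simp add: powr_powr powr_mult m_def field_simps)
    also have "\<dots> \<le> N powr (real m / 4) * A powr (real m * \<rho> / 4) * \<delta> powr (real m * \<gamma>)"
      using that by (intro mult_left_mono powr_mono') auto
    finally show ?thesis .
  qed
  let ?F = "sqrt (A1 powr \<rho>1 * (M1 * \<delta>1 powr \<beta>1))" and ?G = "sqrt (A2 powr \<rho>2 * (M2 * \<delta>2 powr \<beta>2))"
  have ratio: "(r\<^sup>2 * c)\<^sup>2 * (16 * ?F * ?G / (r ^ 4 * \<alpha>\<^sup>2)) = (4 * c / \<alpha>)\<^sup>2 * (?F * ?G)"
  proof -
    have "(r\<^sup>2 * c)\<^sup>2 * (16 * ?F * ?G / (r ^ 4 * \<alpha>\<^sup>2)) = r ^ 4 * (16 * c\<^sup>2 * (?F * ?G)) / (r ^ 4 * \<alpha>\<^sup>2)"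
      by (simp add: power_mult_distrib mult_ac flip: power_mult)
    also have "\<dots> = 16 * c\<^sup>2 * (?F * ?G) / \<alpha>\<^sup>2"
      using r by simp
    finally show ?thesis by (simp add: power_mult_distrib power_divide)
  qed
  have pow: "X ^ m * (f * Y ^ k) = f * (X\<^sup>2 * Y) ^ k" for X Y f :: real
    by (simp add: m_def power_mult power_mult_distrib)
  have "(r\<^sup>2 * c) ^ m * ((fact m)\<^sup>2 * (16 * ?F * ?G / (r ^ 4 * \<alpha>\<^sup>2)) ^ k)
      = (fact m)\<^sup>2 * ((4 * c / \<alpha>)\<^sup>2 * (?F * ?G)) ^ k"
    unfolding pow ratio ..
  also have "\<dots> = ((4 * c / \<alpha>) ^ m * (fact m)\<^sup>2) * (?F ^ k * ?G ^ k)"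
    unfolding pow[symmetric] by (simp only: power_mult_distrib mult_ac)
  also have "\<dots> \<le> ((4 * c / \<alpha>) ^ m * (fact m)\<^sup>2)
      * ((M1 powr (real m / 4) * A1 powr (real m * \<rho>1 / 4) * \<delta>1 powr (real m * \<gamma>))
        * (M2 powr (real m / 4) * A2 powr (real m * \<rho>2 / 4) * \<delta>2 powr (real m * \<gamma>)))"
    using A M \<delta> \<gamma> by (intro mult_left_mono mult_mono half) (auto simp: m_def zero_le_even_power)
  also have "\<dots> = ((4 * c / \<alpha>) ^ m * (fact m)\<^sup>2 * (M1 * M2) powr (real m / 4))
      * A1 powr (real m * \<rho>1 / 4) * A2 powr (real m * \<rho>2 / 4) * (\<delta>1 * \<delta>2) powr (real m * \<gamma>)"
    by (simp add: powr_mult mult_ac)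
  finally show ?thesis .
qed

text \<open>The integral of the squared kernel increment over the side of the rectangle is at most
  \<open>(G s' - G s)^\<rho>\<close> by (ii') and at most \<open>M (s0' - s0)^\<beta>\<close> by (iii), hence at most the geometric mean of
  both. This is where half of each exponent goes.\<close>
lemma sheet_moment_bound:
  fixes L :: "real \<Rightarrow> real \<Rightarrow> 'a \<Rightarrow> real"
  assumes L: "levy_sheet M L (\<lambda>\<xi>. complex_of_real (a \<xi>) + \<i> * complex_of_real (b \<xi>))"
    and field: "measurable_field M L"
    and K1: "kernel_cond K1 G1 \<rho>1 M1 \<beta>1" and K2: "kernel_cond K2 G2 \<rho>2 M2 \<beta>2"
    and trig: "trig \<in> {cos, sin}"
    and s: "0 \<le> s" "s \<le> s'" "s' \<le> 1" and t: "0 \<le> t" "t \<le> t'" "t' \<le> 1"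
    and s0: "0 < s0" "s0 < s0'" "s0' < 2 * s0" "s0' \<le> 1"
    and t0: "0 < t0" "t0 < t0'" "t0' < 2 * t0" "t0' \<le> 1"
    and k: "0 < k" and \<alpha>: "0 < \<alpha>" "\<And>j. j \<in> {1..2 * k} \<Longrightarrow> \<alpha> \<le> a (real j * \<theta>)"
    and \<gamma>: "\<gamma> \<le> \<beta>1 / 4" "\<gamma> \<le> \<beta>2 / 4"
  defines "m \<equiv> 2 * k"
  shows "(\<integral>\<omega>. (rect_incr (Y_process K1 K2 s t s' t' (sheet_kernel trig c \<theta> L n) \<omega>) s0 t0 s0' t0') ^ m \<partial>M)
    \<le> ((4 * c / \<alpha>) ^ m * (fact m)\<^sup>2 * (M1 * M2) powr (real m / 4))
      * (G1 s' - G1 s) powr (real m * \<rho>1 / 4) * (G2 t' - G2 t) powr (real m * \<rho>2 / 4)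
      * ((s0' - s0) * (t0' - t0)) powr (real m * \<gamma>)" (is "?lhs \<le> ?rhs")
proof -
  interpret prob_space M using L by (rule levy_sheet_prob_space)
  define f where "f = (\<lambda>x. indicator {s0<..s0'} x * (indicator {0..1} x * (K1 s' x - K1 s x)))"
  define g where "g = (\<lambda>y. indicator {t0<..t0'} y * (indicator {0..1} y * (K2 t' y - K2 t y)))"
  define J where "J \<omega> = (\<integral>x. \<integral>y. (f x * sqrt x) * (g y * sqrt y)
      * trig (\<theta> * L (sqrt (real n) * x) (sqrt (real n) * y) \<omega>) \<partial>lborel \<partial>lborel)" for \<omega>
  have "rect_incr (Y_process K1 K2 s t s' t' (sheet_kernel trig c \<theta> L n) \<omega>) s0 t0 s0' t0' = real n * c * J \<omega>"
    if "\<omega> \<in> space M" for \<omega>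
    unfolding J_def f_def g_def
    by (rule rect_incr_Y_process[OF field that trig K1 K2 s t]) (use s0 t0 in auto)
  then have "?lhs = (\<integral>\<omega>. (real n * c) ^ m * J \<omega> ^ m \<partial>M)"
    by (intro Bochner_Integration.integral_cong) (simp_all add: power_mult_distrib)
  then have lhs: "?lhs = (real n * c) ^ m * (\<integral>\<omega>. J \<omega> ^ m \<partial>M)"
    by simp
  show ?thesis
  proof (cases "n = 0")
    case True
    then have "?lhs = 0" using lhs k by (simp add: m_def)
    moreover have "0 \<le> ?rhs"
      by (intro mult_nonneg_nonneg) (auto simp: m_def zero_le_even_power)
    ultimately show ?thesis by linarith
  next
    case False
    define A1 where "A1 = G1 s' - G1 s"
    define A2 where "A2 = G2 t' - G2 t"
    have M: "0 < M1" "0 < M2" using K1 K2 by (auto simp: kernel_cond_def)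
    have "mono_on {0..1} G1" "mono_on {0..1} G2" using K1 K2 by (auto simp: kernel_cond_def)
    then have A: "0 \<le> A1" "0 \<le> A2"
      using s t by (auto simp: A1_def A2_def mono_on_def)
    have le_sqrt: "X \<le> ennreal (sqrt (u * v))" if "X \<le> ennreal u" "X \<le> ennreal v" "0 \<le> u" "0 \<le> v" for X u v
    proof -
      have "min u v \<le> sqrt (u * v)"
        using that(3,4) by (intro real_le_rsqrt) (auto simp: power2_eq_square min_def mult_mono)
      then have "ennreal (min u v) \<le> ennreal (sqrt (u * v))" by (rule ennreal_leI)
      moreover have "X \<le> ennreal (min u v)" using that by (auto simp: min_def)
      ultimately show ?thesis by (rule order_trans[rotated])
    qed
    define F where "F = sqrt (A1 powr \<rho>1 * (M1 * (s0' - s0) powr \<beta>1))"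
    define G where "G = sqrt (A2 powr \<rho>2 * (M2 * (t0' - t0) powr \<beta>2))"
    note k1 = kernel_increment[OF K1 s] and k2 = kernel_increment[OF K2 t]
    have meas: "f \<in> borel_measurable borel" "g \<in> borel_measurable borel"
      unfolding f_def g_def using k1(1) k2(1) by auto
    have "(\<integral>\<^sup>+x. ennreal ((f x)\<^sup>2) \<partial>lborel) \<le> ennreal F"
      unfolding F_def
    proof (rule le_sqrt)
      have "(\<integral>\<^sup>+x. ennreal ((f x)\<^sup>2) \<partial>lborel)
          \<le> (\<integral>\<^sup>+x. ennreal ((indicator {0..1} x * (K1 s' x - K1 s x))\<^sup>2) \<partial>lborel)"
        by (intro nn_integral_mono) (auto simp: f_def indicator_def)
      also note k1(2)
      finally show "(\<integral>\<^sup>+x. ennreal ((f x)\<^sup>2) \<partial>lborel) \<le> ennreal (A1 powr \<rho>1)" unfolding A1_def .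
      show "(\<integral>\<^sup>+x. ennreal ((f x)\<^sup>2) \<partial>lborel) \<le> ennreal (M1 * (s0' - s0) powr \<beta>1)"
        unfolding f_def by (rule k1(3)) (use s0 in auto)
    qed (use M in auto)
    moreover have "(\<integral>\<^sup>+y. ennreal ((g y)\<^sup>2) \<partial>lborel) \<le> ennreal G"
      unfolding G_def
    proof (rule le_sqrt)
      have "(\<integral>\<^sup>+y. ennreal ((g y)\<^sup>2) \<partial>lborel)
          \<le> (\<integral>\<^sup>+y. ennreal ((indicator {0..1} y * (K2 t' y - K2 t y))\<^sup>2) \<partial>lborel)"
        by (intro nn_integral_mono) (auto simp: g_def indicator_def)
      also note k2(2)
      finally show "(\<integral>\<^sup>+y. ennreal ((g y)\<^sup>2) \<partial>lborel) \<le> ennreal (A2 powr \<rho>2)" unfolding A2_def .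
      show "(\<integral>\<^sup>+y. ennreal ((g y)\<^sup>2) \<partial>lborel) \<le> ennreal (M2 * (t0' - t0) powr \<beta>2)"
        unfolding g_def by (rule k2(3)) (use t0 in auto)
    qed (use M in auto)
    moreover have r: "0 < sqrt (real n)" using False by simp
    moreover have "0 \<le> F" "0 \<le> G" using M by (simp_all add: F_def G_def)
    moreover have "s0 \<le> x \<and> x \<le> 2 * s0" if "f x \<noteq> 0" for x
      using that s0 by (auto simp: f_def indicator_def split: if_splits)
    moreover have "t0 \<le> y \<and> y \<le> 2 * t0" if "g y \<noteq> 0" for y
      using that t0 by (auto simp: g_def indicator_def split: if_splits)
    ultimately have "(\<integral>\<omega>. J \<omega> ^ m \<partial>M) \<le> (fact m)\<^sup>2 * (16 * F * G / (sqrt (real n) ^ 4 * \<alpha>\<^sup>2)) ^ k"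
      unfolding J_def m_def
      by (intro sheet_integral_moment_le[OF L field _ s0(1) t0(1) \<alpha> trig meas]) auto
    then have "?lhs \<le> (real n * c) ^ m * ((fact m)\<^sup>2 * (16 * F * G / (sqrt (real n) ^ 4 * \<alpha>\<^sup>2)) ^ k)"
      unfolding lhs by (intro mult_left_mono) (simp_all add: m_def zero_le_even_power)
    then have "?lhs \<le> ((sqrt (real n))\<^sup>2 * c) ^ m
        * ((fact m)\<^sup>2 * (16 * F * G / (sqrt (real n) ^ 4 * \<alpha>\<^sup>2)) ^ k)" by simp
    also have "\<dots> \<le> ?rhs"
      unfolding F_def G_def A1_def[symmetric] A2_def[symmetric] m_def
      by (rule kernel_moment_constant) (use A M s0 t0 \<gamma> k \<alpha>(1) r in auto)
    finally show ?thesis .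
  qed
qed

theorem lemma4p4:
  shows "\<exists>(\<gamma> :: real \<Rightarrow> real \<Rightarrow> real) (m :: real \<Rightarrow> real \<Rightarrow> nat).
    (\<forall>\<beta>1>0. \<forall>\<beta>2>0. 0 < \<gamma> \<beta>1 \<beta>2 \<and> \<gamma> \<beta>1 \<beta>2 < 1) \<and>
    (\<forall>\<rho>1\<in>{0<..1}. \<forall>\<rho>2\<in>{0<..1}. even (m \<rho>1 \<rho>2) \<and> real (m \<rho>1 \<rho>2) > 4 / min \<rho>1 \<rho>2) \<and>
    (\<forall>(a :: real \<Rightarrow> real) (b :: real \<Rightarrow> real) (\<theta> :: real). 0 < \<theta> \<and> \<theta> < 2 * pi \<longrightarrow>
      (\<exists>C :: nat \<Rightarrow> real \<Rightarrow> real \<Rightarrow> real.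
        \<forall>(M :: 'a measure) L K1 K2 G1 G2 \<rho>1 \<rho>2 M1 M2 \<beta>1 \<beta>2.
          levy_sheet M L (\<lambda>\<xi>. complex_of_real (a \<xi>) + \<i> * complex_of_real (b \<xi>)) \<and>
          measurable_field M L \<and>
          kernel_cond K1 G1 \<rho>1 M1 \<beta>1 \<and> kernel_cond K2 G2 \<rho>2 M2 \<beta>2 \<and>
          (\<Prod>k = 1..m \<rho>1 \<rho>2. a (real k * \<theta>)) \<noteq> 0 \<longrightarrow>
          (\<forall>trig\<in>{cos, sin}. \<forall>s s' t t' s0 s0' t0 t0'. \<forall>n :: nat.
            0 \<le> s \<and> s \<le> s' \<and> s' \<le> 1 \<and> 0 \<le> t \<and> t \<le> t' \<and> t' \<le> 1 \<and>
            0 < s0 \<and> s0 < s0' \<and> s0' < 2 * s0 \<and> s0' \<le> 1 \<and>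
            0 < t0 \<and> t0 < t0' \<and> t0' < 2 * t0 \<and> t0' \<le> 1 \<longrightarrow>
            prob_space.expectation M
              (\<lambda>\<omega>. (rect_incr
                 (Y_process K1 K2 s t s' t' (sheet_kernel trig (norm_const a b \<theta>) \<theta> L n) \<omega>)
                 s0 t0 s0' t0') ^ m \<rho>1 \<rho>2)
            \<le> C (m \<rho>1 \<rho>2) M1 M2
               * (G1 s' - G1 s) powr (real (m \<rho>1 \<rho>2) * \<rho>1 / 4)
               * (G2 t' - G2 t) powr (real (m \<rho>1 \<rho>2) * \<rho>2 / 4)
               * ((s0' - s0) * (t0' - t0)) powr (real (m \<rho>1 \<rho>2) * \<gamma> \<beta>1 \<beta>2))))"
proof -
  \<comment> \<open>The exponents \<open>\<beta>\<^sub>i / 4\<close> are the ones that the proof yields; the cap \<open>1 / 2\<close> keeps \<open>\<gamma>\<close> below 1.\<close>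
  define \<gamma> :: "real \<Rightarrow> real \<Rightarrow> real" where "\<gamma> \<beta>1 \<beta>2 = min (1 / 2) (min (\<beta>1 / 4) (\<beta>2 / 4))" for \<beta>1 \<beta>2
  \<comment> \<open>The successor makes the inequality strict; doubling makes \<open>m\<close> even.\<close>
  define k :: "real \<Rightarrow> real \<Rightarrow> nat" where "k \<rho>1 \<rho>2 = Suc (nat \<lceil>4 / min \<rho>1 \<rho>2\<rceil>)" for \<rho>1 \<rho>2
  define m where "m \<rho>1 \<rho>2 = 2 * k \<rho>1 \<rho>2" for \<rho>1 \<rho>2
  show ?thesis
  proof (intro exI[of _ \<gamma>] exI[of _ m] conjI allI ballI impI)
    fix \<beta>1 \<beta>2 :: real assume "0 < \<beta>1" "0 < \<beta>2"
    then show "0 < \<gamma> \<beta>1 \<beta>2" "\<gamma> \<beta>1 \<beta>2 < 1" by (simp_all add: \<gamma>_def min_def)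
  next
    fix \<rho>1 \<rho>2 :: real
    show "even (m \<rho>1 \<rho>2)" by (simp add: m_def)
    have "4 / min \<rho>1 \<rho>2 \<le> real (nat \<lceil>4 / min \<rho>1 \<rho>2\<rceil>)" by (rule real_nat_ceiling_ge)
    then show "4 / min \<rho>1 \<rho>2 < real (m \<rho>1 \<rho>2)" by (simp add: m_def k_def)
  next
    fix a b :: "real \<Rightarrow> real" and \<theta> :: real
    \<comment> \<open>For the exponent of a sheet this minimum is positive as soon as the product of the values is
      nonzero, because then \<open>a \<ge> 0\<close>.\<close>
    define \<alpha> where "\<alpha> j = Min ((\<lambda>i. a (real i * \<theta>)) ` {1..j})" for j :: nat
    define C where "C j M1 M2 = (4 * norm_const a b \<theta> / \<alpha> j) ^ j * (fact j)\<^sup>2 * (M1 * M2) powr (real j / 4)"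
      for j :: nat and M1 M2 :: real
    show "\<exists>C :: nat \<Rightarrow> real \<Rightarrow> real \<Rightarrow> real.
        \<forall>(M :: 'a measure) L K1 K2 G1 G2 \<rho>1 \<rho>2 M1 M2 \<beta>1 \<beta>2.
          levy_sheet M L (\<lambda>\<xi>. complex_of_real (a \<xi>) + \<i> * complex_of_real (b \<xi>)) \<and>
          measurable_field M L \<and>
          kernel_cond K1 G1 \<rho>1 M1 \<beta>1 \<and> kernel_cond K2 G2 \<rho>2 M2 \<beta>2 \<and>
          (\<Prod>k = 1..m \<rho>1 \<rho>2. a (real k * \<theta>)) \<noteq> 0 \<longrightarrow>
          (\<forall>trig\<in>{cos, sin}. \<forall>s s' t t' s0 s0' t0 t0'. \<forall>n :: nat.
            0 \<le> s \<and> s \<le> s' \<and> s' \<le> 1 \<and> 0 \<le> t \<and> t \<le> t' \<and> t' \<le> 1 \<and>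
            0 < s0 \<and> s0 < s0' \<and> s0' < 2 * s0 \<and> s0' \<le> 1 \<and>
            0 < t0 \<and> t0 < t0' \<and> t0' < 2 * t0 \<and> t0' \<le> 1 \<longrightarrow>
            prob_space.expectation M
              (\<lambda>\<omega>. (rect_incr
                 (Y_process K1 K2 s t s' t' (sheet_kernel trig (norm_const a b \<theta>) \<theta> L n) \<omega>)
                 s0 t0 s0' t0') ^ m \<rho>1 \<rho>2)
            \<le> C (m \<rho>1 \<rho>2) M1 M2
               * (G1 s' - G1 s) powr (real (m \<rho>1 \<rho>2) * \<rho>1 / 4)
               * (G2 t' - G2 t) powr (real (m \<rho>1 \<rho>2) * \<rho>2 / 4)
               * ((s0' - s0) * (t0' - t0)) powr (real (m \<rho>1 \<rho>2) * \<gamma> \<beta>1 \<beta>2))"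
    proof (intro exI[of _ C] allI ballI impI; (elim conjE)?)
      fix M :: "'a measure" and L K1 K2 G1 G2 \<rho>1 \<rho>2 M1 M2 \<beta>1 \<beta>2
        and trig :: "real \<Rightarrow> real" and s s' t t' s0 s0' t0 t0' :: real and n :: nat
      assume L: "levy_sheet M L (\<lambda>\<xi>. complex_of_real (a \<xi>) + \<i> * complex_of_real (b \<xi>))"
        and field: "measurable_field M L"
        and K: "kernel_cond K1 G1 \<rho>1 M1 \<beta>1" "kernel_cond K2 G2 \<rho>2 M2 \<beta>2"
        and nz: "(\<Prod>k = 1..m \<rho>1 \<rho>2. a (real k * \<theta>)) \<noteq> 0" and trig: "trig \<in> {cos, sin}"
        and s: "0 \<le> s" "s \<le> s'" "s' \<le> 1" and t: "0 \<le> t" "t \<le> t'" "t' \<le> 1"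
        and s0: "0 < s0" "s0 < s0'" "s0' < 2 * s0" "s0' \<le> 1"
        and t0: "0 < t0" "t0 < t0'" "t0' < 2 * t0" "t0' \<le> 1"
      have k: "0 < k \<rho>1 \<rho>2" by (simp add: k_def)
      have "0 < a (real i * \<theta>)" if "i \<in> {1..m \<rho>1 \<rho>2}" for i
        using nz that levy_sheet_exponent(1)[OF L, of "real i * \<theta>"] by (auto simp: less_le)
      then have \<alpha>: "0 < \<alpha> (m \<rho>1 \<rho>2)"
        using k by (auto simp: \<alpha>_def m_def)
      show "prob_space.expectation M
              (\<lambda>\<omega>. (rect_incr
                 (Y_process K1 K2 s t s' t' (sheet_kernel trig (norm_const a b \<theta>) \<theta> L n) \<omega>)
                 s0 t0 s0' t0') ^ m \<rho>1 \<rho>2)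
            \<le> C (m \<rho>1 \<rho>2) M1 M2
               * (G1 s' - G1 s) powr (real (m \<rho>1 \<rho>2) * \<rho>1 / 4)
               * (G2 t' - G2 t) powr (real (m \<rho>1 \<rho>2) * \<rho>2 / 4)
               * ((s0' - s0) * (t0' - t0)) powr (real (m \<rho>1 \<rho>2) * \<gamma> \<beta>1 \<beta>2)"
        unfolding C_def m_def
        by (rule sheet_moment_bound[OF L field K trig s t s0 t0 k \<alpha>[unfolded m_def]])
          (auto simp: \<alpha>_def \<gamma>_def intro!: Min_le)
    qed
  qed
qed

end
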